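(* Let $y_0$ be an algebraic number with $y_0^2\in\mathbb{Q}$. Define $\phi_{y_0}$ as the larger root of the quadratic equation $$x^2-y_0x-1=0,$$ that is, $\phi_{y_0}=\frac{y_0+\sqrt{y_0^2+4}}{2}$. Then $\phi_{y_0}$ can be realized as a ratio of polygon diagonals if and only if $$y_0\in\left\{0,\pm1,\pm\tfrac{3}{2},\pm2,\pm\sqrt{2},\pm\sqrt{5},\pm\sqrt{12},\pm\tfrac{\sqrt{2}}{2},\pm\tfrac{\sqrt{6}}{6},\pm\tfrac{2\sqrt{3}}{3},\pm\tfrac{\sqrt{12}}{12}\right\}.$$
   Context: A diagonal of a regular $N$-gon ($N\ge 3$) is the distance between any two distinct vertices of the polygon (so side lengths are allowed). A number is realized as a ratio of polygon diagonals if it equals $d_1/d_2$ for two diagonals $d_1,d_2$ of the same regular $N$-gon, for some $N\geq 3$. Equivalently, taking the vertices to be the $N$-th roots of unity in $\mathbb{C}$, it equals $\frac{|1-\zeta_N^a|}{|1-\zeta_N^b|}$ for some $N\ge 3$, where $\zeta_N$ is a primitive $N$-th root of unity and $a,b$ are integers not divisible by $N$. The square root $\sqrt{\cdot}$ is the principal one. *)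

theory Defs
  imports Complex_Main "HOL-Computational_Algebra.Polynomial"
begin

(* Every regular N-gon in the plane, N \<ge> 3, is the image of the N-th roots of unity under
   z \<mapsto> c + w z, where c is the centre and w \<noteq> 0 fixes size and orientation. *)

definition regular_polygon :: "nat \<Rightarrow> complex set \<Rightarrow> bool" where
  "regular_polygon N P \<longleftrightarrow>
     N \<ge> 3 \<and> (\<exists>c w. w \<noteq> 0 \<and> P = (\<lambda>z. c + w * z) ` {z. z ^ N = 1})"

definition diagonals :: "complex set \<Rightarrow> real set" where
  "diagonals P = {dist u v | u v. u \<in> P \<and> v \<in> P \<and> u \<noteq> v}"

definition ratio_of_polygon_diagonals :: "complex \<Rightarrow> bool" where
  "ratio_of_polygon_diagonals x \<longleftrightarrow>
     (\<exists>N P d1 d2. regular_polygon N P \<and> d1 \<in> diagonals P \<and> d2 \<in> diagonals P \<and>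
        x = complex_of_real (d1 / d2))"

definition phi :: "complex \<Rightarrow> complex" where
  "phi y = (y + csqrt (y\<^sup>2 + 4)) / 2"

(* phi y is a root of x^2 - y x - 1, and for real y it is the larger of the two (real) roots. *)

lemma phi_root: "(phi y)\<^sup>2 - y * phi y - 1 = 0"
proof -
  have "(csqrt (y\<^sup>2 + 4))\<^sup>2 = y\<^sup>2 + 4"
    by simp
  then show ?thesis
    unfolding phi_def by (simp add: power2_eq_square field_simps)
qed

lemma phi_of_real: "phi (complex_of_real y) = complex_of_real ((y + sqrt (y\<^sup>2 + 4)) / 2)"
proof -
  have "csqrt (complex_of_real (y\<^sup>2 + 4)) = complex_of_real (sqrt (y\<^sup>2 + 4))"
    by (subst of_real_sqrt) simp_all
  then show ?thesis
    by (simp add: phi_def)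
qed

lemma phi_larger_root:
  fixes x y :: real
  assumes "x\<^sup>2 - y * x - 1 = 0"
  shows "x \<le> Re (phi (complex_of_real y))"
proof -
  have "(2 * x - y)\<^sup>2 = y\<^sup>2 + 4"
    using assms by (simp add: power2_eq_square algebra_simps)
  then have "2 * x - y \<le> sqrt (y\<^sup>2 + 4)"
    by (metis real_le_rsqrt order_refl)
  then show ?thesis
    by (simp add: phi_of_real del: of_real_divide of_real_add)
qed

end

(* Writing the ratio as |1 - z| / |1 - w| with roots of unity z and w, its square is r = A / B with
   A = |1 - z|^2 = 2 - 2 Re z and B = 2 - 2 Re w, and r + 1 / r = y0^2 + 2 =: s is rational, that is
   A^2 + B^2 = s A B. By irreducibility of the cyclotomic polynomials this relation survives
   (z, w) -> (z^k, w^k) for every k prime to the order N of the pair, so the ratio A / B of every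
   conjugate pair is again r or 1 / r. Only two kinds of k are needed. If 4 divides N, k = N / 2 + 1
   changes the sign of z or of w (or both), hence replaces A by 4 - A or B by 4 - B. If not, up to signs
   z and w have odd order and k = 2, 4, 8 are allowed; they act on A and B by polynomial maps. In
   each case the resulting equations leave finitely many values of s; this uses that an algebraic
   integer in Q is an integer and, when exactly one of the two signs is negative, that the
   resultants of these equations have no root modulo 3. *)

theory Submission
  imports Defs "HOL-Computational_Algebra.Computational_Algebra"
begin

section \<open>Conjugation of roots of unity\<close>

text \<open>The hard case pairs \<open>|1 - z|^2\<close> with \<open>|1 + w|^2\<close> for
  \<open>z\<close>, \<open>w\<close> of odd order. For equal signs both numbers move by the same
  map, \<open>a - b\<close> splits off, and what remains is symmetric: one doubling leaves a curve
  in the plane of \<open>S = a + b\<close> and \<open>P = a * b\<close>, further ones finitely many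
  points. For opposite signs the maps differ, nothing cancels, and eliminating the chords leaves
  \<open>A(s) + B(s) * r = 0\<close> with integer polynomials \<open>A\<close>, \<open>B\<close> and
  the ratio \<open>r\<close>. Splitting this into \<open>A(s) = 0\<close> and
  \<open>B(s) = 0\<close> needs \<open>r\<close> irrational; reducing modulo 3 needs
  \<open>s\<close> integral. At a \<open>flip\<close> step both follow from \<open>1 + w\<close>
  being a unit when \<open>w\<close> is not 1. Chords and ratios are written as values of integer
  polynomials at a single root of unity \<open>x\<close>. Then division by the minimal polynomial of
  \<open>x\<close> gives the required integrality without ring closure of the algebraic integers,
  and irreducibility takes the form that an integer polynomial vanishing at \<open>x\<close> also
  vanishes at \<open>x^k\<close>.\<close>

definition ipoly :: "int poly \<Rightarrow> 'a \<Rightarrow> 'a::comm_ring_1" where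
  "ipoly p x = poly (map_poly of_int p) x"

lemma ipoly_0 [simp]: "ipoly 0 x = 0"
  by (simp add: ipoly_def)

lemma ipoly_pCons [simp]: "ipoly (pCons a p) x = of_int a + x * ipoly p x"
  by (simp add: ipoly_def map_poly_pCons)

lemma ipoly_1 [simp]: "ipoly 1 x = 1"
  by (simp add: one_pCons)

lemma ipoly_add [simp]: "ipoly (p + q) x = ipoly p x + ipoly q x"
  by (induction p q rule: poly_induct2) (simp_all add: algebra_simps)

lemma ipoly_smult [simp]: "ipoly (smult c p) x = of_int c * ipoly p x"
  by (induction p) (simp_all add: algebra_simps)

lemma ipoly_diff [simp]: "ipoly (p - q) x = ipoly p x - ipoly q x"
  using ipoly_add[of "p - q" q x] by simp

lemma ipoly_mult [simp]: "ipoly (p * q) x = ipoly p x * ipoly q x"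
  by (induction p) (simp_all add: algebra_simps)

lemma ipoly_power [simp]: "ipoly (p ^ n) x = ipoly p x ^ n"
  by (induction n) simp_all

lemma ipoly_monom [simp]: "ipoly (monom c n) x = of_int c * x ^ n"
  by (simp add: ipoly_def map_poly_monom poly_monom)

lemma ipoly_pcompose: "ipoly (pcompose p q) x = ipoly p (ipoly q x)"
  by (induction p) (simp_all add: pcompose_pCons)

section \<open>Congruences modulo a prime\<close>

lemma binomial_prime_power_cong:
  fixes x y :: "'a::comm_ring_1"
  assumes "prime p"
  shows "of_nat p dvd (x + y) ^ p - x ^ p - y ^ p"
proof -
  have "p > 0"
    using assms prime_gt_0_nat by blast
  have "(x + y) ^ p = (\<Sum>k\<le>p. of_nat (p choose k) * x ^ k * y ^ (p - k))"
    by (rule binomial_ring)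
  also have "{..p} = insert 0 (insert p {1..<p})"
    using \<open>p > 0\<close> by auto
  finally have "(x + y) ^ p - x ^ p - y ^ p = (\<Sum>k\<in>{1..<p}. of_nat (p choose k) * x ^ k * y ^ (p - k))"
    using \<open>p > 0\<close> by simp
  moreover have "of_nat p dvd (of_nat (p choose k) * x ^ k * y ^ (p - k) :: 'a)" if "k \<in> {1..<p}" for k
  proof -
    have "p dvd p choose k"
      using that assms by (intro dvd_choose_prime) auto
    then show ?thesis
      by (metis dvd_mult2 of_nat_dvd_iff of_nat_mult dvdE dvd_triv_left)
  qed
  ultimately show ?thesis
    by (metis (no_types, lifting) dvd_sum)
qed

lemma prime_dvd_power_diff_self:
  fixes a :: int
  assumes "prime p"
  shows "int p dvd a ^ p - a"
proof -
  have step: "int p dvd (a + 1) ^ p - (a + 1) - (a ^ p - a)" for a :: int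
    using binomial_prime_power_cong[OF assms, of a 1] by (simp add: algebra_simps)
  show ?thesis
  proof (induction a rule: int_induct[of _ 0])
    case base
    then show ?case
      using prime_gt_0_nat[OF assms] by (simp add: power_0_left)
  next
    case (step1 i)
    show ?case
      using dvd_add[OF step[of i] step1(2)] by (simp add: algebra_simps)
  next
    case (step2 i)
    show ?case
      using dvd_diff[OF step2(2) step[of "i - 1"]] by (simp add: algebra_simps)
  qed
qed

text \<open>Modulo \<open>p\<close> the \<open>p\<close>-th power is additive and fixes integer
  constants, so the claim passes from \<open>f\<close> to \<open>a + X * f\<close>.\<close>

lemma frobenius_int_poly:
  fixes f :: "int poly"
  assumes "prime p"
  shows "of_nat p dvd pcompose f (monom 1 p) - f ^ p"
proof (induction f)
  case 0
  then show ?case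
    using prime_gt_0_nat[OF assms] by (simp add: power_0_left)
next
  case (pCons a f)
  have X: "pCons a f = [:a:] + [:0, 1:] * f" for a and f :: "int poly"
    by simp
  obtain c where "a ^ p - a = int p * c"
    using prime_dvd_power_diff_self[OF assms, of a] ..
  then have "[:a:] - [:a:] ^ p = of_nat p * [:- c:]"
    by (simp add: poly_const_pow of_nat_poly algebra_simps)
  then have 1: "of_nat p dvd [:a:] - [:a:] ^ p" ..
  have 2: "of_nat p dvd (pCons a f) ^ p - [:a:] ^ p - ([:0, 1:] * f) ^ p"
    unfolding X[of a f] by (rule binomial_prime_power_cong[OF assms])
  have 3: "of_nat p dvd monom 1 p * (pcompose f (monom 1 p) - f ^ p)"
    using pCons.IH by simp
  have m: "[:0, 1:] ^ p = (monom 1 p :: int poly)"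
    by (simp add: monom_altdef)
  have "pcompose (pCons a f) (monom 1 p) - (pCons a f) ^ p =
     monom 1 p * (pcompose f (monom 1 p) - f ^ p) + ([:a:] - [:a:] ^ p)
      - ((pCons a f) ^ p - [:a:] ^ p - ([:0, 1:] * f) ^ p)"
    unfolding power_mult_distrib m pcompose_pCons by (simp add: algebra_simps)
  then show ?case
    using 1 2 3 by (metis dvd_add dvd_diff)
qed


text \<open>A primitive integer polynomial of least degree vanishing at \<open>x\<close> divides a
  nonzero integer multiple of every vanishing \<open>h\<close> by pseudo-division; passing to
  primitive parts (Gauss) removes that multiple. Since it divides a monic polynomial, its leading
  coefficient is 1 or -1.\<close>

lemma algebraic_int_monic_minimal_poly:
  fixes x :: "'a::field_char_0"
  assumes "algebraic_int x"
  obtains f where "lead_coeff f = 1" "ipoly f x = 0" "\<And>h. ipoly h x = 0 \<Longrightarrow> f dvd h"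
proof -
  obtain g where g: "ipoly g x = 0" "lead_coeff g = 1"
    using assms unfolding algebraic_int_altdef_ipoly ipoly_def by blast
  then have "g \<noteq> 0"
    by auto
  define P where "P h \<longleftrightarrow> h \<noteq> 0 \<and> ipoly h x = 0" for h
  obtain f0 where f0: "P f0" and min: "\<And>h. P h \<Longrightarrow> degree f0 \<le> degree h"
    using g \<open>g \<noteq> 0\<close> exists_least_iff[of "\<lambda>n. \<exists>h. P h \<and> degree h = n"]
    by (metis P_def linorder_not_le)
  define f1 where "f1 = primitive_part f0"
  have "of_int (content f0) * ipoly f1 x = ipoly (smult (content f0) f1) x"
    by simp
  also have "smult (content f0) f1 = f0"
    by (simp add: f1_def)
  finally have "of_int (content f0) * ipoly f1 x = 0"
    using f0 by (simp add: P_def)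
  then have f1: "f1 \<noteq> 0" "ipoly f1 x = 0" "content f1 = 1" "degree f1 = degree f0"
    using f0 by (simp_all add: f1_def P_def)
  have dvd: "f1 dvd h" if "ipoly h x = 0" for h
  proof (cases "h = 0")
    case False
    obtain a q where aq: "a \<noteq> 0" "smult a h = f1 * q + pseudo_mod h f1"
      using pseudo_mod(1)[OF f1(1)] by blast
    have "ipoly (pseudo_mod h f1) x = ipoly (smult a h) x - ipoly (f1 * q) x"
      unfolding aq(2) by simp
    also have "\<dots> = 0"
      using that f1 by simp
    finally have "pseudo_mod h f1 = 0"
      using pseudo_mod(2)[OF f1(1), of h] min[of "pseudo_mod h f1"] f1(4)
      by (metis P_def leD)
    with aq have "f1 dvd smult a h"
      by simp
    then have "primitive_part f1 dvd primitive_part (smult a h)"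
      by blast
    then have "f1 dvd smult (unit_factor a) (primitive_part h)"
      using f1(3) by (simp add: primitive_part_prim primitive_part_smult)
    then have "f1 dvd primitive_part h"
      using aq(1) by (cases "a > 0") simp_all
    then show ?thesis
      by (metis content_times_primitive_part dvd_smult)
  qed simp
  from dvd[OF g(1)] obtain q where "g = f1 * q" ..
  then have "lead_coeff f1 * lead_coeff q = 1"
    using g(2) by (metis lead_coeff_mult)
  then have lc: "lead_coeff f1 * lead_coeff f1 = 1"
    by (metis zmult_eq_1_iff mult_minus1 mult_1 minus_minus)
  show thesis
  proof (rule that[of "smult (lead_coeff f1) f1"])
    show "lead_coeff (smult (lead_coeff f1) f1) = 1"
      using lc f1(1) by simp
    show "ipoly (smult (lead_coeff f1) f1) x = 0"
      using f1 by simp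
    show "smult (lead_coeff f1) f1 dvd h" if hx: "ipoly h x = 0" for h
    proof -
      obtain u where "h = f1 * u"
        using dvd[OF hx] by (rule dvdE)
      then have "h = smult (lead_coeff f1) f1 * smult (lead_coeff f1) u"
        using lc by simp
      then show ?thesis ..
    qed
  qed
qed

text \<open>Division by the monic minimal polynomial replaces \<open>h\<close> by a remainder
  \<open>r\<close> with the same value at \<open>x\<close>. If this value is \<open>a / b\<close>,
  then \<open>b * r - a\<close> vanishes at \<open>x\<close> in too small a degree, so it is 0 and
  \<open>r\<close> is an integer constant.\<close>

lemma Rats_ipoly_imp_Ints:
  fixes x :: "'a::field_char_0"
  assumes "algebraic_int x" "ipoly h x \<in> \<rat>"
  shows "ipoly h x \<in> \<int>"
proof -
  obtain f where f: "lead_coeff f = 1" "ipoly f x = 0" "\<And>h. ipoly h x = 0 \<Longrightarrow> f dvd h"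
    using algebraic_int_monic_minimal_poly[OF assms(1)] by blast
  have "f \<noteq> 0"
    using f(1) by auto
  have "degree f > 0"
  proof (rule ccontr)
    assume "\<not> degree f > 0"
    then have "f = 1"
      using f(1) by (metis gr0I degree_0_id of_int_1 degree_eq_zeroE lead_coeff_pCons(2) one_pCons pCons_0_0 coeff_pCons_0)
    then show False
      using f(2) by simp
  qed
  obtain q r where qr: "pseudo_divmod h f = (q, r)"
    by fastforce
  \<comment> \<open>As \<open>f\<close> is monic, the factor introduced by pseudo-division is
    1.\<close>
  have h: "h = f * q + r" and r: "r = 0 \<or> degree r < degree f"
    using pseudo_divmod[OF \<open>f \<noteq> 0\<close> qr] f(1) by auto
  have rx: "ipoly r x = ipoly h x"
    using f(2) by (simp add: h)
  obtain a b where ab: "b \<noteq> 0" "ipoly h x = of_int a / of_int b"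
    using assms(2) by (metis Rats_cases' of_int_0_less_iff less_irrefl)
  define e where "e = smult b r - [:a:]"
  have "ipoly e x = 0"
    using ab by (simp add: e_def rx)
  then have "f dvd e"
    by (rule f(3))
  moreover have "degree e < degree f"
    using r \<open>degree f > 0\<close> unfolding e_def
    by (intro degree_diff_less) (auto intro: le_less_trans[OF degree_smult_le])
  ultimately have "e = 0"
    using dvd_imp_degree_le leD by blast
  then have "degree (smult b r) = 0"
    unfolding e_def by simp
  then have "degree r = 0"
    using ab(1) by simp
  then obtain c where "r = [:c:]"
    by (rule degree_eq_zeroE)
  then show ?thesis
    using rx by (metis Ints_of_int add.right_neutral ipoly_0 ipoly_pCons mult_zero_right)
qed

lemma algebraic_int_root_of_unity:
  fixes x :: "'a::field_char_0"
  assumes "x ^ N = 1" "N > 0"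
  shows "algebraic_int x"
proof -
  have "ipoly (monom 1 N - 1) x = 0"
    using assms by simp
  moreover have "lead_coeff (monom 1 N - 1 :: int poly) = 1"
    using assms(2) lead_coeff_add_le[of "- 1" "monom 1 N :: int poly"]
    by (simp add: degree_monom_eq)
  ultimately show ?thesis
    unfolding algebraic_int_altdef_ipoly ipoly_def by blast
qed

text \<open>
  The minimal polynomial f of x satisfies f(x^p) = p * u with u an integer combination of powers of x.
  If this were nonzero, the cofactor q of f in X^N - 1 would vanish at x^p, and differentiating
  X^N - 1 = f q there would make N / p such a combination as well, hence an integer.
\<close>

lemma ipoly_root_of_unity_prime_power:
  fixes x :: "'a::field_char_0"
  assumes x: "x ^ N = 1" and N: "N > 0" and p: "prime p" "\<not> p dvd N" and h: "ipoly h x = 0"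
  shows "ipoly h (x ^ p) = 0"
proof -
  have alg: "algebraic_int x"
    using algebraic_int_root_of_unity[OF x N] .
  obtain f where f: "ipoly f x = 0" "\<And>h. ipoly h x = 0 \<Longrightarrow> f dvd h"
    using algebraic_int_monic_minimal_poly[OF alg] by blast
  let ?y = "x ^ p"
  have y: "?y ^ N = 1"
    using x by (metis mult.commute power_mult power_one)
  have "ipoly f ?y = 0"
  proof (rule ccontr)
    assume nz: "ipoly f ?y \<noteq> 0"
    have "ipoly (monom 1 N - 1) x = 0"
      using x by simp
    then obtain q where q: "monom 1 N - 1 = f * q"
      using f(2) by blast
    have "ipoly f ?y * ipoly q ?y = ipoly (monom 1 N - 1) ?y"
      by (simp add: q)
    then have qy: "ipoly q ?y = 0"
      using nz y by simp
    obtain u where u: "pcompose f (monom 1 p) - f ^ p = of_nat p * u"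
      using frobenius_int_poly[OF p(1), of f] ..
    have "ipoly f ?y = ipoly (pcompose f (monom 1 p)) x"
      by (simp add: ipoly_pcompose)
    also have "pcompose f (monom 1 p) = f ^ p + smult (int p) u"
      using u by (simp add: of_nat_poly algebra_simps)
    finally have fy: "ipoly f ?y = of_nat p * ipoly u x"
      using f(1) prime_gt_0_nat[OF p(1)] by (simp add: power_0_left)
    have "pderiv (monom 1 N - 1 :: int poly) = f * pderiv q + q * pderiv f"
      unfolding q by (rule pderiv_mult)
    then have "ipoly (monom (int N) (N - 1)) ?y = ipoly (f * pderiv q + q * pderiv f) ?y"
      by (simp add: pderiv_diff pderiv_monom)
    then have "of_nat N * ?y ^ (N - 1) = of_nat p * ipoly u x * ipoly (pderiv q) ?y"
      by (simp add: qy fy)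
    then have "of_nat N * (?y ^ (N - 1) * ?y) = of_nat p * (ipoly u x * ipoly (pderiv q) ?y * ?y)"
      by (simp add: mult.assoc[symmetric])
    moreover have "?y ^ (N - 1) * ?y = 1"
      using y N by (metis power_minus_mult)
    ultimately have "of_nat N = of_nat p * (ipoly u x * ipoly (pderiv q) ?y * ?y)"
      by (metis mult_1_right)
    then have eq: "of_nat N = of_nat p * ipoly (u * pcompose (pderiv q) (monom 1 p) * monom 1 p) x"
      by (simp add: ipoly_pcompose)
    define w where "w = ipoly (u * pcompose (pderiv q) (monom 1 p) * monom 1 p) x"
    have "w = of_nat N / of_nat p"
      using eq prime_gt_0_nat[OF p(1)] by (simp add: w_def field_simps)
    then have "w \<in> \<int>"
      unfolding w_def by (intro Rats_ipoly_imp_Ints[OF alg]) simp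
    then obtain m where "w = of_int m"
      by (rule Ints_cases)
    with eq have "(of_int (int N) :: 'a) = of_int (int p * m)"
      by (simp add: w_def)
    then have "int N = int p * m"
      by (simp only: of_int_eq_iff)
    then show False
      using p(2) by (metis dvd_triv_left of_nat_dvd_iff)
  qed
  moreover have "f dvd h"
    using f(2) h .
  ultimately show ?thesis
    by (auto elim!: dvdE)
qed

text \<open>Prime factors of \<open>k\<close> are peeled off one at a time: if
  \<open>k = p * m\<close>, then \<open>x^m\<close> is again an \<open>N\<close>-th root of unity
  and \<open>p\<close> does not divide \<open>N\<close>.\<close>

lemma ipoly_root_of_unity_power:
  fixes x :: "'a::field_char_0"
  assumes x: "x ^ N = 1" and N: "N > 0" and h: "ipoly h x = 0" and k: "coprime k N" "k > 0"
  shows "ipoly h (x ^ k) = 0"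
  using k
proof (induction k rule: less_induct)
  case (less k)
  show ?case
  proof (cases "k = 1")
    case False
    then obtain p m where p: "prime p" "k = p * m"
      using prime_factor_nat[of k] by (metis dvdE)
    then have "m < k" "m > 0" "coprime m N" "coprime p N"
      using less.prems prime_gt_1_nat[of p] by auto
    then have "ipoly h (x ^ m) = 0" "\<not> p dvd N"
      using less.IH p(1) by (auto simp: prime_nat_iff coprime_absorb_left)
    moreover have "(x ^ m) ^ N = 1"
      using x by (metis mult.commute power_mult power_one)
    ultimately have "ipoly h ((x ^ m) ^ p) = 0"
      using ipoly_root_of_unity_prime_power N p(1) by blast
    then show ?thesis
      by (simp add: p(2) power_mult[symmetric] mult.commute)
  qed (use h in simp)
qed

section \<open>The relation between conjugate pairs\<close>

text \<open>
  For a = 2 - 2 cos t and c = 2 + 2 cos t, these maps give 2 - 2 cos 2t and 2 + 2 cos 2t.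
\<close>

definition dbl :: "real \<Rightarrow> real" where
  "dbl a = a * (4 - a)"

definition dbl' :: "real \<Rightarrow> real" where
  "dbl' c = (c - 2)\<^sup>2"

text \<open>
  The ratio a / b is a root of x^2 - s x + 1. Two pairs in this relation with the same s have equal or
  inverse ratios (cases same and flip below).
\<close>

definition rel :: "real \<Rightarrow> real \<Rightarrow> real \<Rightarrow> bool" where
  "rel s a b \<longleftrightarrow> a > 0 \<and> b > 0 \<and> a\<^sup>2 + b\<^sup>2 = s * a * b"

lemma rel_sym: "rel s a b \<Longrightarrow> rel s b a"
  by (auto simp: rel_def algebra_simps)

lemma rel_same: "rel s a a \<Longrightarrow> s = 2"
  by (auto simp: rel_def power2_eq_square)

lemma rel_cases:
  assumes "rel s a b" "rel s a' b'"
  obtains (same) "a * b' = a' * b" | (flip) "a * a' = b * b'"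
proof -
  have "(a * b' - a' * b) * (a * a' - b * b') = a' * b' * (a\<^sup>2 + b\<^sup>2) - a * b * (a'\<^sup>2 + b'\<^sup>2)"
    by algebra
  also have "\<dots> = 0"
    using assms by (simp add: rel_def)
  finally show ?thesis
    using that by auto
qed

lemma rel_ge_2:
  assumes "rel s a b"
  shows "s \<ge> 2"
proof -
  have "(s - 2) * (a * b) = (a - b)\<^sup>2"
    using assms by (simp add: rel_def power2_eq_square algebra_simps)
  then have "(s - 2) * (a * b) \<ge> 0"
    by simp
  then show ?thesis
    using assms unfolding rel_def by (metis diff_ge_0_iff_ge mult_pos_pos not_less zero_le_mult_iff order_less_irrefl)
qed

section \<open>Pairs with equal signs\<close>

lemma rel_dbl_dbl:
  assumes 0: "rel s a b" and 1: "rel s (dbl a) (dbl b)" and 2: "rel s (dbl (dbl a)) (dbl (dbl b))"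
  shows "s \<in> {2, 3}"
proof -
  have flip: "s = 2 \<or> a * b = (a + b) * (a + b - 4)" if "rel s a b" "rel s (dbl a) (dbl b)" for a b
    using that
  proof (cases rule: rel_cases)
    case same
    then have "a * b * (a - b) = 0"
      by (simp add: dbl_def algebra_simps)
    then have "a = b"
      using that by (auto simp: rel_def)
    then show ?thesis
      using rel_same that by blast
  next
    case flip
    then have "(a - b) * (a * b - (a + b) * (a + b - 4)) = 0"
      unfolding dbl_def by algebra
    then show ?thesis
      using rel_same that by fastforce
  qed
  show ?thesis
  proof (cases "s = 2")
    case False
    define S P where "S = a + b" and "P = a * b"
    have P: "P = S * (S - 4)"
      using flip[OF 0 1] False by (simp add: S_def P_def)
    have "P > 0"
      using 0 by (simp add: P_def rel_def)
    have "dbl a + dbl b = 4 * S - S\<^sup>2 + 2 * P" "dbl a * dbl b = P * (16 - 4 * S + P)"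
      by (simp_all add: S_def P_def dbl_def power2_eq_square algebra_simps)
    then have "P * (16 - 4 * S + P) = (4 * S - S\<^sup>2 + 2 * P) * (4 * S - S\<^sup>2 + 2 * P - 4)"
      using flip[OF 1 2] False by simp
    moreover have "4 * S - S\<^sup>2 + 2 * P = P"
      using P by (simp add: power2_eq_square algebra_simps)
    ultimately have "16 - 4 * S + P = P - 4"
      using \<open>P > 0\<close> by simp
    \<comment> \<open>Hence \<open>a\<close> and \<open>b\<close> are the roots of
      \<open>X^2 - 5 * X + 5\<close>, the squared diagonals of the regular pentagon in the unit
      circle.\<close>
    then have "S = 5" "P = 5"
      using P by auto
    moreover have "S\<^sup>2 - 2 * P = s * P"
      using 0 by (simp add: S_def P_def rel_def power2_eq_square algebra_simps)
    ultimately show ?thesis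
      by simp
  qed simp
qed

lemma Rats_power2_eq_int:
  fixes x :: real
  assumes "x \<in> \<rat>" "x\<^sup>2 = of_int n"
  obtains m where "n = m\<^sup>2"
proof -
  have "algebraic_int (x\<^sup>2)"
    using assms(2) by (simp add: int_imp_algebraic_int)
  then have "algebraic_int x"
    using algebraic_int_root[of "x\<^sup>2" "monom 1 2" x] by (simp add: poly_monom degree_monom_eq)
  then obtain m where "x = of_int m"
    using assms(1) rational_algebraic_int_is_int by (auto elim: Ints_cases)
  then have "real_of_int (m\<^sup>2) = of_int n"
    using assms(2) by simp
  then show thesis
    using that by (metis of_int_eq_iff)
qed

lemma Rats_power2_between_squares:
  fixes x :: real
  assumes "x \<in> \<rat>" "x\<^sup>2 = of_int n" "k \<ge> 0" "k\<^sup>2 < n" "n < (k + 1)\<^sup>2"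
  shows False
proof -
  obtain m where m: "n = m\<^sup>2"
    using Rats_power2_eq_int[OF assms(1,2)] .
  then have "k < \<bar>m\<bar>" "\<bar>m\<bar> < k + 1"
    using assms(3-5) power2_less_imp_less[of k "\<bar>m\<bar>"] power2_less_imp_less[of "\<bar>m\<bar>" "k + 1"] by auto
  then show False
    by simp
qed

lemma rel_dbl'_step:
  assumes 0: "rel s a b" and 1: "rel s (dbl' a) (dbl' b)" and "s \<noteq> 2"
  obtains (same) "a * b = 4" | (flip) "a * b = (a + b - 2)\<^sup>2"
proof -
  have "a \<noteq> b"
    using 0 assms(3) rel_same by blast
  from 0 1 show thesis
  proof (cases rule: rel_cases)
    case same
    then have "(a - b) * (a * b - 4) = 0"
      unfolding dbl'_def by algebra
    then show thesis
      using \<open>a \<noteq> b\<close> that by simp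
  next
    case flip
    then have "(a - b) * (a * b - (a + b - 2)\<^sup>2) = 0"
      unfolding dbl'_def by algebra
    then show thesis
      using \<open>a \<noteq> b\<close> that by simp
  qed
qed

text \<open>The equation \<open>a * b = 4\<close> is the \<open>same\<close> outcome of the first
  doubling. It makes \<open>(a + b)^2 = 4 * s + 8\<close> rational, so an integer quadratic equation
  for \<open>a + b\<close> with nonzero linear term makes \<open>a + b\<close> itself rational. The
  \<open>flip\<close> outcome of the second doubling gives such equations, with the non-squares 3
  and 11 after completing the square.\<close>

lemma rel_dbl'_dbl'_same:
  assumes "s \<in> \<rat>" and 0: "rel s a b" and 1: "rel s (dbl' a) (dbl' b)"
    and 2: "rel s (dbl' (dbl' a)) (dbl' (dbl' b))" and ab: "a * b = 4"
  shows "s \<in> {2, 17/4}"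
proof (cases "s = 2")
  case False
  define S where "S = a + b"
  have "S > 0"
    using 0 by (simp add: S_def rel_def)
  have "S\<^sup>2 - 8 = a\<^sup>2 + b\<^sup>2"
    using ab by (simp add: S_def power2_eq_square algebra_simps)
  also have "\<dots> = 4 * s"
    using 0 ab by (simp add: rel_def mult.assoc)
  finally have S2: "S\<^sup>2 = 4 * s + 8"
    by simp
  have sum1: "dbl' a + dbl' b = S\<^sup>2 - 4 * S"
    using ab by (simp add: dbl'_def S_def power2_eq_square algebra_simps)
  have "(a - 2) * (b - 2) = - (2 * (S - 4))"
    using ab by (simp add: S_def algebra_simps)
  then have prod1: "dbl' a * dbl' b = 4 * (S - 4)\<^sup>2"
    by (simp add: dbl'_def power_mult_distrib[symmetric]) (simp add: power2_eq_square algebra_simps)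
  have irr: False if "(S - of_int c)\<^sup>2 = of_int n" "c \<noteq> 0" "k \<ge> 0" "k\<^sup>2 < n" "n < (k + 1)\<^sup>2" for c n k :: int
  proof -
    have "S = (S\<^sup>2 + (of_int c)\<^sup>2 - of_int n) / (2 * of_int c)"
      using that(1,2) by (simp add: field_simps power2_eq_square)
    also have "\<dots> \<in> \<rat>"
      using assms(1) unfolding S2 by simp
    finally have "S \<in> \<rat>" .
    then show False
      using Rats_power2_between_squares[of "S - of_int c" n k] that by simp
  qed
  from 1 2 False show ?thesis
  proof (cases rule: rel_dbl'_step)
    case same
    then have "(S - 4)\<^sup>2 = 1\<^sup>2"
      using prod1 by simp
    then have "S = 5 \<or> S = 3"
      by (auto simp only: power2_eq_iff)
    \<comment> \<open>\<open>S = 3\<close> would mean \<open>s = 1/4\<close>, below the bound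
      2.\<close>
    then show ?thesis
      using S2 rel_ge_2[OF 0] by auto
  next
    case flip
    moreover have "(2 * (S - 4))\<^sup>2 = 4 * (S - 4)\<^sup>2"
      by (subst power_mult_distrib) simp
    ultimately have "(2 * (S - 4))\<^sup>2 = (S\<^sup>2 - 4 * S - 2)\<^sup>2"
      by (simp only: sum1 prod1)
    then have "2 * (S - 4) = S\<^sup>2 - 4 * S - 2 \<or> 2 * (S - 4) = - (S\<^sup>2 - 4 * S - 2)"
      by (simp only: power2_eq_iff)
    then have "(S - of_int 3)\<^sup>2 = of_int 3 \<or> (S - of_int 1)\<^sup>2 = of_int 11"
      by (auto simp: power2_eq_square algebra_simps)
    then show ?thesis
      using irr[of 3 3 1] irr[of 1 11 3] by auto
  qed
qed simp

text \<open>The third doubling serves the sequence \<open>flip\<close>, \<open>same\<close>: there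
  the preceding lemma is applied one level higher. Two flips give two curves in \<open>S\<close> and
  \<open>P\<close> whose intersections have \<open>s = 3\<close> or \<open>s = 7\<close>, that is
  \<open>g^2 + g^(-2)\<close> or \<open>g^4 + g^(-4)\<close> for the golden ratio
  \<open>g\<close>.\<close>

lemma rel_dbl'_dbl':
  assumes "s \<in> \<rat>" and 0: "rel s a b" and 1: "rel s (dbl' a) (dbl' b)"
    and 2: "rel s (dbl' (dbl' a)) (dbl' (dbl' b))"
    and 3: "rel s (dbl' (dbl' (dbl' a))) (dbl' (dbl' (dbl' b)))"
  shows "s \<in> {2, 3, 7, 17/4}"
proof (cases "s = 2")
  case False
  define S P where "S = a + b" and "P = a * b"
  have s: "S\<^sup>2 - 2 * P = s * P" and "P > 0"
    using 0 by (simp_all add: S_def P_def rel_def power2_eq_square algebra_simps)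
  from 0 1 False show ?thesis
  proof (cases rule: rel_dbl'_step)
    case same
    then show ?thesis
      using rel_dbl'_dbl'_same[OF assms(1) 0 1 2] by auto
  next
    case flip
    then have P: "P = (S - 2)\<^sup>2"
      by (simp add: P_def S_def)
    from 1 2 False show ?thesis
    proof (cases rule: rel_dbl'_step)
      case same
      then show ?thesis
        using rel_dbl'_dbl'_same[OF assms(1) 1 2 3] by auto
    next
      case flip
      have "dbl' a * dbl' b = (P - 2 * S + 4)\<^sup>2"
        unfolding dbl'_def S_def P_def by algebra
      moreover have "dbl' a + dbl' b = S\<^sup>2 - 2 * P - 4 * S + 8"
        unfolding dbl'_def S_def P_def by algebra
      ultimately have "(P - 2 * S + 4)\<^sup>2 = (S\<^sup>2 - 2 * P - 4 * S + 8 - 2)\<^sup>2"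
        using flip by metis
      then have "(P - 2 * S + 4)\<^sup>2 = (S\<^sup>2 - 2 * P - 4 * S + 6)\<^sup>2"
        by (simp add: algebra_simps)
      then have "P - 2 * S + 4 = S\<^sup>2 - 2 * P - 4 * S + 6 \<or> P - 2 * S + 4 = - (S\<^sup>2 - 2 * P - 4 * S + 6)"
        by (simp only: power2_eq_iff)
      then have "S\<^sup>2 = 5 * (S - 1) \<and> P = S - 1 \<or> S = 3 \<and> P = 1"
        unfolding P by (auto simp: power2_eq_square algebra_simps)
      then have "S\<^sup>2 - 2 * P = 3 * P \<or> S\<^sup>2 - 2 * P = 7 * P"
        by auto
      then show ?thesis
        using \<open>P > 0\<close> unfolding s by auto
    qed
  qed
qed simp

section \<open>Pairs in which one chord is fixed by all power maps\<close>

lemma rel_2_dbl: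
  assumes 0: "rel s 2 b" and 1: "rel s 2 (dbl b)" and 2: "rel s 2 (dbl (dbl b))"
  shows "s = 13/6"
proof -
  have step: "s = 13/6 \<or> b * dbl b = 4" if "rel s 2 b" "rel s 2 (dbl b)" for b
    using that
  proof (cases rule: rel_cases)
    case same
    then have "b = 3"
      using that(1) by (simp add: dbl_def rel_def)
    then show ?thesis
      using that(1) by (simp add: rel_def)
  qed simp
  show ?thesis
  proof (rule ccontr)
    assume "s \<noteq> 13/6"
    then have 3: "b * dbl b = 4" "dbl b * dbl (dbl b) = 4"
      using step 0 1 2 by blast+
    \<comment> \<open>Two flips would put \<open>b\<close> on a 2-cycle of \<open>dbl\<close>;
      together with \<open>b * dbl b = 4\<close> this leaves only 1 and 3 as candidates, and neither
      satisfies \<open>b * dbl b = 4\<close>.\<close>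
    then have "dbl (dbl b) = b"
      using 0 1 by (metis mult.commute mult_cancel_left rel_def less_irrefl)
    then have "dbl b * (4 - dbl b) = b"
      by (simp add: dbl_def[of "dbl b"])
    then have "(b * dbl b) * (4 * b - b * dbl b) = b * b\<^sup>2"
      by (simp add: power2_eq_square algebra_simps)
    moreover have "b * b\<^sup>2 = 4 * b\<^sup>2 - 4"
      using 3(1) by (simp add: dbl_def power2_eq_square algebra_simps)
    ultimately have "(b - 1) * (b - 3) = 0"
      unfolding 3(1) by (simp add: power2_eq_square algebra_simps)
    then show False
      using 3(1) by (auto simp: dbl_def)
  qed
qed

text \<open>The fixed points 1 and 4 of \<open>dbl'\<close> both stand to 2 in the ratio 2 or 1/2,
  hence the single value 5/2. Two flips would again be a 2-cycle; it forces \<open>b^4 = 16\<close>,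
  but \<open>dbl' 2 = 0\<close>.\<close>

lemma rel_2_dbl':
  assumes 0: "rel s 2 b" and 1: "rel s 2 (dbl' b)" and 2: "rel s 2 (dbl' (dbl' b))"
  shows "s = 5/2"
proof -
  have step: "s = 5/2 \<or> b * dbl' b = 4" if "rel s 2 b" "rel s 2 (dbl' b)" for b
    using that
  proof (cases rule: rel_cases)
    case same
    then have "(b - 1) * (b - 4) = 0"
      by (simp add: dbl'_def power2_eq_square algebra_simps)
    then have "b = 1 \<or> b = 4"
      by simp
    then show ?thesis
      using that(1) by (auto simp: rel_def)
  qed simp
  show ?thesis
  proof (rule ccontr)
    assume "s \<noteq> 5/2"
    then have 3: "b * dbl' b = 4" "dbl' b * dbl' (dbl' b) = 4"
      using step 0 1 2 by blast+
    then have "dbl' (dbl' b) = b"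
      using 0 1 by (metis mult.commute mult_cancel_left rel_def less_irrefl)
    then have "(dbl' b - 2)\<^sup>2 = b"
      by (simp add: dbl'_def[of "dbl' b"])
    have "b * (b * dbl' b - 2 * b)\<^sup>2 = b ^ 3 * (dbl' b - 2)\<^sup>2"
      by (simp add: power2_eq_square power3_eq_cube algebra_simps)
    also have "\<dots> = b ^ 4"
      unfolding \<open>(dbl' b - 2)\<^sup>2 = b\<close> by (simp add: power3_eq_cube power4_eq_xxxx)
    finally have "b * (4 - 2 * b)\<^sup>2 = b ^ 4"
      unfolding 3(1) .
    moreover have "b * (4 - 2 * b)\<^sup>2 = 4 * (b * dbl' b)"
      by (simp add: dbl'_def power2_eq_square algebra_simps)
    ultimately have "4 * (b * dbl' b) = b ^ 4"
      by simp
    then have "(b - 2) * (b + 2) * (b\<^sup>2 + 4) = 0"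
      unfolding 3(1) by (simp add: power2_eq_square power4_eq_xxxx algebra_simps)
    moreover have "b\<^sup>2 + 4 > 0" "b + 2 > 0"
      using 0 by (auto simp: rel_def add_nonneg_pos)
    ultimately have "b = 2"
      by simp
    then show False
      using 3(1) by (auto simp: dbl'_def)
  qed
qed

text \<open>Here 4 is \<open>|1 + w|^2\<close> at \<open>w = 1\<close>. A \<open>flip\<close> would
  require \<open>a * dbl a = 16\<close>, impossible since \<open>a < 4\<close> and
  \<open>dbl a \<le> 4\<close>.\<close>

lemma rel_4_dbl:
  assumes 0: "rel s a 4" and 1: "rel s (dbl a) 4"
  shows "s = 25/12"
  using 0 1
proof (cases rule: rel_cases)
  case same
  then have "a = 3"
    using 0 by (simp add: dbl_def rel_def)
  then show ?thesis
    using 0 by (simp add: rel_def)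
next
  case flip
  have pos: "a > 0" "4 - a > 0"
    using 0 1 by (auto simp: rel_def dbl_def zero_less_mult_iff)
  have "4 * dbl a = 16 - 4 * (a - 2)\<^sup>2"
    by (simp add: dbl_def power2_eq_square algebra_simps)
  then have "dbl a \<le> 4"
    using zero_le_power2[of "a - 2"] by linarith
  then have "a * dbl a \<le> a * 4"
    using pos by (intro mult_left_mono) auto
  then show ?thesis
    using flip pos by simp
qed

section \<open>Opposite signs\<close>

lemma rel_ratio:
  assumes "rel s a c"
  shows "(a / c)\<^sup>2 = s * (a / c) - 1" "a / c > 0" "a = a / c * c"
  using assms by (auto simp: rel_def field_simps power2_eq_square)

text \<open>With \<open>a = r * c\<close> each outcome of a doubling becomes a quadratic equation
  for \<open>c\<close> whose coefficients involve only \<open>r\<close> and \<open>s\<close>.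
  Comparing those of two consecutive levels eliminates \<open>c\<close>.\<close>

lemma rel_same_quadratic:
  assumes "rel s a c" "a * dbl' c = dbl a * c"
  shows "(a / c + 1) * c\<^sup>2 = 8 * c - 4"
proof -
  have "a * (c - 2)\<^sup>2 = a * (c * (4 - a))"
    using assms(2) by (simp add: dbl_def dbl'_def algebra_simps)
  then have "(c - 2)\<^sup>2 = c * (4 - a)"
    using assms(1) by (simp add: rel_def)
  moreover have "(a / c + 1) * c\<^sup>2 = a * c + c\<^sup>2"
    using assms(1) by (simp add: rel_def field_simps power2_eq_square)
  ultimately show ?thesis
    by (simp add: power2_eq_square algebra_simps)
qed

text \<open>After one factor \<open>c\<close> is cancelled, the leading coefficient is
  \<open>r^3 + 1\<close>, which \<open>r^2 = s * r - 1\<close> turns into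
  \<open>(s - 1) * r * (r + 1)\<close>.\<close>

lemma rel_flip_quadratic:
  assumes "rel s a c" "a * dbl a = c * dbl' c"
  defines "r \<equiv> a / c"
  shows "(s - 1) * r * (r + 1) * c\<^sup>2 - 4 * s * r * c + 4 = 0"
proof -
  have r: "r\<^sup>2 = s * r - 1" and a: "a = r * c"
    using rel_ratio[OF assms(1)] unfolding r_def by blast+
  have "c * (r\<^sup>2 * c * (4 - r * c)) = c * (c - 2)\<^sup>2"
    using assms(2) unfolding a dbl_def dbl'_def by (simp add: power2_eq_square algebra_simps)
  then have eq: "r\<^sup>2 * c * (4 - r * c) = (c - 2)\<^sup>2"
    using assms(1) by (simp add: rel_def)
  have "r * r\<^sup>2 + 1 = (s - 1) * r * (r + 1)"
    using r by algebra
  then have "(s - 1) * r * (r + 1) * c\<^sup>2 = (r * r\<^sup>2 + 1) * c\<^sup>2"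
    by simp
  moreover have "4 * (s * r) * c = 4 * (r\<^sup>2 + 1) * c"
    using r by simp
  ultimately show ?thesis
    using eq by (simp add: power2_eq_square algebra_simps)
qed

text \<open>Two \<open>same\<close> steps keep \<open>r\<close>, so \<open>c\<close> and
  \<open>dbl' c\<close> are roots of one quadratic. That quadratic also makes
  \<open>u = (r + 1) * dbl' c\<close> linear in \<open>c\<close>, so the condition on
  \<open>dbl' c\<close> reduces to a linear equation for \<open>c\<close>.\<close>

lemma rel_same_same:
  assumes s: "s \<in> \<rat>" and rel: "rel s a c" "rel s (dbl a) (dbl' c)"
    and same0: "a * dbl' c = dbl a * c"
    and same1: "dbl a * dbl' (dbl' c) = dbl (dbl a) * dbl' c"
  shows "s \<in> {2, 10/3, 25/12}"
proof -
  define r where "r = a / c"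
  define u where "u = 4 * (1 - r) * c + 4 * r"
  define k where "k = 4 * r\<^sup>2 - 7 * r + 5"
  have r: "r\<^sup>2 = s * r - 1" "r > 0"
    using rel_ratio[OF rel(1)] unfolding r_def by auto
  have q0: "(r + 1) * c\<^sup>2 = 8 * c - 4"
    using rel_same_quadratic[OF rel(1) same0] unfolding r_def .
  have "dbl a / dbl' c = r"
    using same0 rel by (simp add: r_def rel_def field_simps)
  then have q1: "(r + 1) * (dbl' c)\<^sup>2 = 8 * dbl' c - 4"
    using rel_same_quadratic[OF rel(2) same1] by simp
  have u: "(r + 1) * dbl' c = u"
  proof -
    have "(r + 1) * dbl' c = (r + 1) * c\<^sup>2 - 4 * (r + 1) * c + 4 * (r + 1)"
      by (simp add: dbl'_def power2_eq_square algebra_simps)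
    also have "\<dots> = u"
      unfolding q0 u_def by algebra
    finally show ?thesis .
  qed
  have "u\<^sup>2 = 8 * u - 4 * (r + 1)"
    using q1 unfolding u[symmetric] by algebra
  moreover have "(r + 1) * u\<^sup>2 = (4 * (1 - r))\<^sup>2 * (8 * c - 4) + 2 * (r + 1) * (4 * (1 - r)) * (4 * r) * c + (r + 1) * (4 * r)\<^sup>2"
    unfolding q0[symmetric] u_def by algebra
  ultimately have "(r + 1) * (8 * u - 4 * (r + 1)) = (4 * (1 - r))\<^sup>2 * (8 * c - 4) + 2 * (r + 1) * (4 * (1 - r)) * (4 * r) * c + (r + 1) * (4 * r)\<^sup>2"
    by simp
  \<comment> \<open>The linear equation degenerates exactly at \<open>r = 3\<close>, the source of
    \<open>s = 10/3\<close>; otherwise its solution for \<open>c\<close> is put back into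
    \<open>q0\<close>.\<close>
  then have "(r - 3) * (k - 8 * (r - 1)\<^sup>2 * c) = 0"
    unfolding u_def k_def by algebra
  then consider "r = 3" | "8 * (r - 1)\<^sup>2 * c = k"
    by fastforce
  then show ?thesis
  proof cases
    case 1
    then show ?thesis
      using r by simp
  next
    case 2
    have "64 * (r - 1) ^ 4 * ((r + 1) * c\<^sup>2) = (r + 1) * (8 * (r - 1)\<^sup>2 * c)\<^sup>2"
      by algebra
    moreover have "64 * (r - 1) ^ 4 * (8 * c - 4) = 64 * (r - 1)\<^sup>2 * (8 * (r - 1)\<^sup>2 * c) - 256 * (r - 1) ^ 4"
      by algebra
    ultimately have "(r + 1) * k\<^sup>2 = 64 * (r - 1)\<^sup>2 * k - 256 * (r - 1) ^ 4"
      unfolding q0 2 by simp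
    then have "(r + 1) * (k - 8 * (r - 1)) * (k + 8 * (r - 1)) = 0"
      unfolding k_def by algebra
    then consider "k - 8 * (r - 1) = 0" | "k + 8 * (r - 1) = 0"
      using r(2) by fastforce
    then show ?thesis
    proof cases
      case 1
      \<comment> \<open>The discriminant of this equation is 17, so \<open>r\<close> is irrational;
        but subtracting \<open>4 * r^2 = 4 * s * r - 4\<close> leaves a linear equation over the
        rationals.\<close>
      then have eq: "4 * r\<^sup>2 = 15 * r - 13"
        by (simp add: k_def)
      with r(1) have lin: "(4 * s - 15) * r = - 9"
        by (simp add: algebra_simps)
      then have "4 * s - 15 \<noteq> 0"
        by auto
      then have "r = - 9 / (4 * s - 15)"
        using lin by (simp add: field_simps)
      then have "8 * r - 15 \<in> \<rat>"
        using s by simp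
      moreover have "(8 * r - 15)\<^sup>2 = of_int 17"
        using eq by (simp add: power2_eq_square algebra_simps)
      ultimately show ?thesis
        using Rats_power2_between_squares[of "8 * r - 15" 17 4] by simp
    next
      case 2
      then have "(4 * r - 3) * (r + 1) = 0"
        by (simp add: k_def power2_eq_square algebra_simps)
      then have "r = 3 / 4"
        using r(2) by simp
      show ?thesis
        using r(1) unfolding \<open>r = 3 / 4\<close> by (simp add: power2_eq_square)
    qed
  qed
qed

section \<open>Excluding integral \<open>s\<close> modulo 3\<close>

lemma poly_dvd_diff: "x - y dvd poly p x - poly p (y :: 'a::comm_ring_1)"
proof (induction p)
  case (pCons a p)
  have "poly (pCons a p) x - poly (pCons a p) y = (x - y) * poly p x + y * (poly p x - poly p y)"
    by (simp add: algebra_simps)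
  then show ?case
    using pCons.IH by simp
qed simp

lemma dvd_3_poly_cases:
  fixes t :: int
  assumes "3 dvd poly p t"
  obtains "3 dvd poly p 0" "3 dvd t" | "3 dvd poly p 1" "3 dvd t - 1" | "3 dvd poly p 2" "3 dvd t - 2"
proof -
  have "3 dvd poly p x" if "3 dvd t - x" for x
    using dvd_trans[OF that poly_dvd_diff[of t x p]] assms by (metis dvd_diff_right_iff dvd_diff_commute)
  moreover have "3 dvd t \<or> 3 dvd t - 1 \<or> 3 dvd t - 2"
    by presburger
  ultimately show thesis
    using that by (metis diff_zero)
qed

text \<open>The polynomial is the part free of \<open>r\<close> in
  \<open>same_flip_resultant\<close>.\<close>

lemma same_flip_elim_no_int_root: "poly [:- 562, - 3, 2631, - 3328, 800, 920, - 688, 176, - 16:] t \<noteq> (0 :: int)"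
proof
  assume "poly [:- 562, - 3, 2631, - 3328, 800, 920, - 688, 176, - 16:] t = 0"
  then have "3 dvd poly [:- 562, - 3, 2631, - 3328, 800, 920, - 688, 176, - 16:] t"
    by simp
  then show False
    by (rule dvd_3_poly_cases) simp_all
qed

text \<open>The two parts of \<open>flip_flip_resultant\<close> must be combined: the first vanishes
  at \<open>t = 1\<close>, and the second is divisible by 3 at \<open>t = 0\<close>. Modulo 3 the
  second leaves only multiples of 3, where the first is congruent to -334.\<close>

lemma flip_flip_elim_no_int_root:
  assumes "poly [:- 334, 3103, 2807, - 23890, 4767, 44828, - 22526, - 31081, 21628, 8075, - 8261, - 172, 1293, - 195, - 57, 16, - 1:] t = (0 :: int)"
    and "poly [:414, 1695, - 12438, - 3039, 50869, - 16562, - 68929, 38180, 38674, - 28715, - 8410, 9495, - 7, - 1351, 211, 56, - 16, 1:] t = 0"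
  shows False
proof -
  have dvd: "3 dvd poly [:- 334, 3103, 2807, - 23890, 4767, 44828, - 22526, - 31081, 21628, 8075, - 8261, - 172, 1293, - 195, - 57, 16, - 1:] t" "3 dvd poly [:414, 1695, - 12438, - 3039, 50869, - 16562, - 68929, 38180, 38674, - 28715, - 8410, 9495, - 7, - 1351, 211, 56, - 16, 1:] t"
    using assms by simp_all
  from dvd(2) have "3 dvd t"
    by (rule dvd_3_poly_cases) simp_all
  then have not_dvd: "\<not> 3 dvd t - 1" "\<not> 3 dvd t - 2"
    by presburger+
  show False
    by (rule dvd_3_poly_cases[OF dvd(1)]) (simp_all add: not_dvd)
qed

lemma irrational_lin_eq_0:
  fixes r :: real
  assumes "of_int x + of_int y * r = 0" "r \<notin> \<rat>"
  shows "x = 0" "y = 0"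
proof -
  show "y = 0"
  proof (rule ccontr)
    assume "y \<noteq> 0"
    then have "r = - of_int x / of_int y"
      using assms(1) by (simp add: field_simps)
    then show False
      using assms(2) by simp
  qed
  then show "x = 0"
    using assms(1) by simp
qed

text \<open>
  With r = a / c, eliminating the second pair leaves a linear equation 4 l c + m = 0 besides the quadratic
  one for c; together they give the resultant below, an equation in r and s only.
\<close>

lemma same_flip_linear:
  fixes r s c :: real
  assumes "r\<^sup>2 = s * r - 1"
  defines "l \<equiv> poly [:- 12, 20, - 11, 2:] s + poly [:0, 8, - 18, 11, - 2:] s * r"
    and "m \<equiv> poly [:28, - 36, 20, - 4:] s + poly [:6, - 23, 32, - 20, 4:] s * r"
  shows "(s - 1) * r * ((4 * (1 - r))\<^sup>2 * (8 * c - 4) + 2 * (r + 1) * (4 * (1 - r)) * (4 * r) * c + (r + 1) * (4 * r)\<^sup>2)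
    - 4 * s * r * (r + 1) * (4 * (1 - r) * c + 4 * r) + 4 * (r + 1)\<^sup>2
  = 4 * (4 * l * c + m)"
  using assms(1) unfolding l_def m_def poly_pCons poly_0 by algebra

text \<open>The left side is \<open>16 * l^2\<close> times the value of
  \<open>(r + 1) * X^2 - 8 * X + 4\<close> at \<open>X = - m / (4 * l)\<close>, reduced by
  \<open>r^2 = s * r - 1\<close> to degree one in \<open>r\<close>.\<close>

lemma same_flip_resultant:
  fixes r s :: real
  assumes "r\<^sup>2 = s * r - 1"
  defines "l \<equiv> poly [:- 12, 20, - 11, 2:] s + poly [:0, 8, - 18, 11, - 2:] s * r"
    and "m \<equiv> poly [:28, - 36, 20, - 4:] s + poly [:6, - 23, 32, - 20, 4:] s * r"
  shows "(r + 1) * m\<^sup>2 + 32 * m * l + 64 * l\<^sup>2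
  = (s + 2) * (poly [:- 562, - 3, 2631, - 3328, 800, 920, - 688, 176, - 16:] s + poly [:- 610, 2537, - 2053, - 2551, 4424, - 1504, - 744, 672, - 176, 16:] s * r)"
  using assms(1) unfolding l_def m_def poly_pCons poly_0 by algebra

lemma rel_same_flip:
  assumes s: "s = of_int t" and rel: "rel s a c" "rel s (dbl a) (dbl' c)"
    and same: "a * dbl' c = dbl a * c"
    and flip: "dbl a * dbl (dbl a) = dbl' c * dbl' (dbl' c)" and irr: "dbl a / dbl' c \<notin> \<rat>"
  shows False
proof -
  define r where "r = a / c"
  define u where "u = 4 * (1 - r) * c + 4 * r"
  define l where "l = poly [:- 12, 20, - 11, 2:] s + poly [:0, 8, - 18, 11, - 2:] s * r"
  define m where "m = poly [:28, - 36, 20, - 4:] s + poly [:6, - 23, 32, - 20, 4:] s * r"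
  have r: "r\<^sup>2 = s * r - 1" "r > 0"
    using rel_ratio[OF rel(1)] unfolding r_def by auto
  have q0: "(r + 1) * c\<^sup>2 = 8 * c - 4"
    using rel_same_quadratic[OF rel(1) same] unfolding r_def .
  have r1: "dbl a / dbl' c = r"
    using same rel by (simp add: r_def rel_def field_simps)
  have q1: "(s - 1) * r * (r + 1) * (dbl' c)\<^sup>2 - 4 * s * r * dbl' c + 4 = 0"
    using rel_flip_quadratic[OF rel(2) flip] unfolding r1 .
  have u: "(r + 1) * dbl' c = u"
  proof -
    have "(r + 1) * dbl' c = (r + 1) * c\<^sup>2 - 4 * (r + 1) * c + 4 * (r + 1)"
      by (simp add: dbl'_def power2_eq_square algebra_simps)
    also have "\<dots> = u"
      unfolding q0 u_def by algebra
    finally show ?thesis .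
  qed
  have "(r + 1) * u\<^sup>2 = (4 * (1 - r))\<^sup>2 * ((r + 1) * c\<^sup>2) + 2 * (r + 1) * (4 * (1 - r)) * (4 * r) * c + (r + 1) * (4 * r)\<^sup>2"
    unfolding u_def by algebra
  \<comment> \<open>The factor \<open>(r + 1)^2\<close> lets \<open>dbl' c\<close> enter only
    through \<open>u\<close>, which is linear in \<open>c\<close>.\<close>
  moreover have "(r + 1)\<^sup>2 * ((s - 1) * r * (r + 1) * (dbl' c)\<^sup>2 - 4 * s * r * dbl' c + 4)
      = (s - 1) * r * ((r + 1) * ((r + 1) * dbl' c)\<^sup>2) - 4 * s * r * (r + 1) * ((r + 1) * dbl' c) + 4 * (r + 1)\<^sup>2"
    by algebra
  ultimately have "4 * (4 * l * c + m) = 0"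
    unfolding q0 q1 u same_flip_linear[OF r(1), of c, folded l_def m_def, symmetric] by (simp add: u_def)
  then have lm: "4 * l * c = - m"
    by simp
  have "16 * l\<^sup>2 * ((r + 1) * c\<^sup>2) = (r + 1) * (4 * l * c)\<^sup>2"
    by algebra
  moreover have "16 * l\<^sup>2 * (8 * c - 4) = 32 * l * (4 * l * c) - 64 * l\<^sup>2"
    by algebra
  ultimately have "(r + 1) * m\<^sup>2 + 32 * m * l + 64 * l\<^sup>2 = 0"
    unfolding q0 lm by (simp add: algebra_simps)
  then have "(s + 2) * (poly [:- 562, - 3, 2631, - 3328, 800, 920, - 688, 176, - 16:] s + poly [:- 610, 2537, - 2053, - 2551, 4424, - 1504, - 744, 672, - 176, 16:] s * r) = 0"
    using same_flip_resultant[OF r(1)] unfolding l_def m_def by simp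
  moreover have "s + 2 > 0"
    using rel_ge_2[OF rel(1)] by simp
  ultimately have "poly [:- 562, - 3, 2631, - 3328, 800, 920, - 688, 176, - 16:] s + poly [:- 610, 2537, - 2053, - 2551, 4424, - 1504, - 744, 672, - 176, 16:] s * r = 0"
    by (metis mult_eq_0_iff less_irrefl)
  then have "of_int (poly [:- 562, - 3, 2631, - 3328, 800, 920, - 688, 176, - 16:] t) + of_int (poly [:- 610, 2537, - 2053, - 2551, 4424, - 1504, - 744, 672, - 176, 16:] t) * r = 0"
    by (simp add: s)
  then have "poly [:- 562, - 3, 2631, - 3328, 800, 920, - 688, 176, - 16:] t = 0"
    by (rule irrational_lin_eq_0) (use irr r1 in simp)
  then show False
    using same_flip_elim_no_int_root by blast
qed

text \<open>The left side is \<open>D^2\<close> times the quadratic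
  \<open>D * X^2 - 4 * s * r^2 * X + 4 * r^3\<close> at \<open>X = dbl' c\<close>, after
  \<open>D * c^2\<close> and \<open>D * dbl' c\<close> have been replaced by linear expressions in
  \<open>c\<close>.\<close>

lemma flip_flip_linear:
  fixes r s c :: real
  assumes "r\<^sup>2 = s * r - 1"
  defines "l \<equiv> poly [:4, 4, - 17, - 11, 19, 1, - 5, 1:] s + poly [:0, - 12, - 12, 31, 13, - 24, 0, 5, - 1:] s * r"
    and "m \<equiv> poly [:- 6, 79, - 22, - 58, 14, 10, 0, - 1:] s + poly [:36, - 2, - 129, 36, 67, - 14, - 11, 0, 1:] s * r"
    and "D \<equiv> (s - 1) * r * (r + 1)"
  shows "(4 * (s * r - D))\<^sup>2 * (4 * s * r * c - 4) + 2 * D * (4 * (s * r - D)) * (4 * (D - 1)) * c + D * (4 * (D - 1))\<^sup>2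
    - 4 * s * r\<^sup>2 * D * (4 * (s * r - D) * c + 4 * (D - 1)) + 4 * r ^ 3 * D\<^sup>2
  = 4 * (4 * l * c + m)"
  using assms(1) unfolding l_def m_def D_def poly_pCons poly_0 by algebra

text \<open>As before, now for the quadratic \<open>D * X^2 - 4 * s * r * X + 4\<close> of
  \<open>c\<close>.\<close>

lemma flip_flip_resultant:
  fixes r s :: real
  assumes "r\<^sup>2 = s * r - 1"
  defines "l \<equiv> poly [:4, 4, - 17, - 11, 19, 1, - 5, 1:] s + poly [:0, - 12, - 12, 31, 13, - 24, 0, 5, - 1:] s * r"
    and "m \<equiv> poly [:- 6, 79, - 22, - 58, 14, 10, 0, - 1:] s + poly [:36, - 2, - 129, 36, 67, - 14, - 11, 0, 1:] s * r"
    and "D \<equiv> (s - 1) * r * (r + 1)"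
  shows "D * m\<^sup>2 + 16 * s * r * m * l + 64 * l\<^sup>2
  = (s - 1)\<^sup>2 * (s + 2) * (poly [:- 334, 3103, 2807, - 23890, 4767, 44828, - 22526, - 31081, 21628, 8075, - 8261, - 172, 1293, - 195, - 57, 16, - 1:] s + poly [:414, 1695, - 12438, - 3039, 50869, - 16562, - 68929, 38180, 38674, - 28715, - 8410, 9495, - 7, - 1351, 211, 56, - 16, 1:] s * r)"
  using assms(1) unfolding l_def m_def D_def poly_pCons poly_0 by algebra

lemma rel_flip_flip:
  assumes s: "s = of_int t" and rel: "rel s a c" "rel s (dbl a) (dbl' c)"
    and flip0: "a * dbl a = c * dbl' c"
    and flip1: "dbl a * dbl (dbl a) = dbl' c * dbl' (dbl' c)" and irr: "a / c \<notin> \<rat>"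
  shows False
proof -
  define r where "r = a / c"
  define D where "D = (s - 1) * r * (r + 1)"
  define u where "u = 4 * (s * r - D) * c + 4 * (D - 1)"
  define l where "l = poly [:4, 4, - 17, - 11, 19, 1, - 5, 1:] s + poly [:0, - 12, - 12, 31, 13, - 24, 0, 5, - 1:] s * r"
  define m where "m = poly [:- 6, 79, - 22, - 58, 14, 10, 0, - 1:] s + poly [:36, - 2, - 129, 36, 67, - 14, - 11, 0, 1:] s * r"
  have r: "r\<^sup>2 = s * r - 1" "r > 0"
    using rel_ratio[OF rel(1)] unfolding r_def by auto
  have q0: "D * c\<^sup>2 = 4 * s * r * c - 4"
    using rel_flip_quadratic[OF rel(1) flip0, folded r_def] unfolding D_def by simp
  \<comment> \<open>A \<open>flip\<close> inverts the ratio, so the second quadratic has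
    \<open>1 / r\<close> in place of \<open>r\<close>; multiplying it by \<open>r^3\<close> restores
    the leading coefficient \<open>D\<close>.\<close>
  have "dbl a / dbl' c = 1 / r"
    using flip0 rel by (simp add: r_def rel_def field_simps)
  then have "(s - 1) * (1 / r) * (1 / r + 1) * (dbl' c)\<^sup>2 - 4 * s * (1 / r) * dbl' c + 4 = 0"
    using rel_flip_quadratic[OF rel(2) flip1] by simp
  then have q1: "D * (dbl' c)\<^sup>2 - 4 * s * r\<^sup>2 * dbl' c + 4 * r ^ 3 = 0"
    using r(2) unfolding D_def by (simp add: field_simps power2_eq_square power3_eq_cube)
  have u: "D * dbl' c = u"
  proof -
    have "D * dbl' c = D * c\<^sup>2 - 4 * D * c + 4 * D"
      by (simp add: dbl'_def power2_eq_square algebra_simps)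
    then show ?thesis
      by (simp add: q0 u_def algebra_simps)
  qed
  have "D * u\<^sup>2 = (4 * (s * r - D))\<^sup>2 * (D * c\<^sup>2) + 2 * D * (4 * (s * r - D)) * (4 * (D - 1)) * c + D * (4 * (D - 1))\<^sup>2"
    unfolding u_def by algebra
  moreover have "D\<^sup>2 * (D * (dbl' c)\<^sup>2 - 4 * s * r\<^sup>2 * dbl' c + 4 * r ^ 3)
      = D * (D * dbl' c)\<^sup>2 - 4 * s * r\<^sup>2 * D * (D * dbl' c) + 4 * r ^ 3 * D\<^sup>2"
    by algebra
  ultimately have "4 * (4 * l * c + m) = 0"
    unfolding q0 q1 u flip_flip_linear[OF r(1), of c, folded l_def m_def D_def, symmetric] by (simp add: u_def)
  then have lm: "4 * l * c = - m"
    by simp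
  have "16 * l\<^sup>2 * (D * c\<^sup>2) = D * (4 * l * c)\<^sup>2"
    by algebra
  moreover have "16 * l\<^sup>2 * (4 * s * r * c - 4) = 16 * s * r * l * (4 * l * c) - 64 * l\<^sup>2"
    by algebra
  ultimately have "D * m\<^sup>2 + 16 * s * r * m * l + 64 * l\<^sup>2 = 0"
    unfolding q0 lm by (simp add: algebra_simps)
  then have "(s - 1)\<^sup>2 * (s + 2) * (poly [:- 334, 3103, 2807, - 23890, 4767, 44828, - 22526, - 31081, 21628, 8075, - 8261, - 172, 1293, - 195, - 57, 16, - 1:] s + poly [:414, 1695, - 12438, - 3039, 50869, - 16562, - 68929, 38180, 38674, - 28715, - 8410, 9495, - 7, - 1351, 211, 56, - 16, 1:] s * r) = 0"
    using flip_flip_resultant[OF r(1)] unfolding l_def m_def D_def by simp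
  moreover have "(s - 1)\<^sup>2 * (s + 2) > 0"
    using rel_ge_2[OF rel(1)] by simp
  ultimately have "poly [:- 334, 3103, 2807, - 23890, 4767, 44828, - 22526, - 31081, 21628, 8075, - 8261, - 172, 1293, - 195, - 57, 16, - 1:] s + poly [:414, 1695, - 12438, - 3039, 50869, - 16562, - 68929, 38180, 38674, - 28715, - 8410, 9495, - 7, - 1351, 211, 56, - 16, 1:] s * r = 0"
    by (metis mult_eq_0_iff less_irrefl)
  then have "of_int (poly [:- 334, 3103, 2807, - 23890, 4767, 44828, - 22526, - 31081, 21628, 8075, - 8261, - 172, 1293, - 195, - 57, 16, - 1:] t) + of_int (poly [:414, 1695, - 12438, - 3039, 50869, - 16562, - 68929, 38180, 38674, - 28715, - 8410, 9495, - 7, - 1351, 211, 56, - 16, 1:] t) * r = 0"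
    by (simp add: s)
  from irrational_lin_eq_0[OF this] show False
    using flip_flip_elim_no_int_root irr unfolding r_def by blast
qed

text \<open>The hypothesis on \<open>flip\<close> is supplied by \<open>flip_imp_Ints\<close>. After
  a \<open>same\<close>, another \<open>same\<close> gives the listed values and a
  \<open>flip\<close> is contradictory; two consecutive flips are contradictory too. So a
  \<open>flip\<close> at level 0 is followed by a \<open>same\<close> at level 1, where the first
  argument applies.\<close>

lemma rel_dbl_dbl'_mixed:
  assumes s: "s \<in> \<rat>" and rel: "\<And>i. rel s ((dbl ^^ i) a) ((dbl' ^^ i) c)"
    and flip: "\<And>i. (dbl ^^ i) a * (dbl ^^ Suc i) a = (dbl' ^^ i) c * (dbl' ^^ Suc i) c \<Longrightarrow> s \<noteq> 2 \<Longrightarrow>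
      s \<in> \<int> \<and> (dbl ^^ i) a / (dbl' ^^ i) c \<notin> \<rat>"
  shows "s \<in> {2, 10/3, 25/12}"
proof (cases "s = 2")
  case False
  have same_step: "s \<in> {2, 10/3, 25/12}" if "(dbl ^^ i) a * (dbl' ^^ Suc i) c = (dbl ^^ Suc i) a * (dbl' ^^ i) c" for i
    using rel[of "Suc i"] rel[of "Suc (Suc i)"]
  proof (cases rule: rel_cases)
    case same
    then show ?thesis
      using rel_same_same[OF s] rel[of i] rel[of "Suc i"] that by simp
  next
    case flip': flip
    then obtain t where "s = of_int t" "(dbl ^^ Suc i) a / (dbl' ^^ Suc i) c \<notin> \<rat>"
      using flip False Ints_cases by metis
    then have False
      using rel_same_flip[of s t "(dbl ^^ i) a" "(dbl' ^^ i) c"] rel[of i] rel[of "Suc i"] that flip' by simp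
    then show ?thesis ..
  qed
  from rel[of 0] rel[of "Suc 0"] show ?thesis
  proof (cases rule: rel_cases)
    case same
    then show ?thesis
      using same_step[of 0] by blast
  next
    case flip0: flip
    then obtain t where t: "s = of_int t" "a / c \<notin> \<rat>"
      using flip[of 0] False Ints_cases by (metis funpow_0)
    from rel[of 1] rel[of "Suc 1"] show ?thesis
    proof (cases rule: rel_cases)
      case same
      then show ?thesis
        using same_step[of 1] by blast
    next
      case flip
      then have False
        using rel_flip_flip[OF t(1) _ _ _ _ t(2)] rel[of 0] rel[of 1] flip0 by simp
      then show ?thesis ..
    qed
  qed
qed simp

section \<open>Squared distances between roots of unity\<close>

text \<open>
  For e = 1 and e = -1 this is |1 - z|^2 and |1 + z|^2 on the unit circle; e = 0 gives the constant 2.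
\<close>

definition chord2 :: "int \<Rightarrow> complex \<Rightarrow> real" where
  "chord2 e z = 2 - 2 * of_int e * Re z"

lemma norm_one_minus_power2:
  assumes "cmod z = 1"
  shows "(cmod (1 - z))\<^sup>2 = chord2 1 z"
proof -
  have "(Re z)\<^sup>2 + (Im z)\<^sup>2 = 1"
    using assms by (metis cmod_power2 one_power2)
  then show ?thesis
    unfolding cmod_power2 by (simp add: chord2_def power2_eq_square algebra_simps)
qed

lemma norm_root_of_unity:
  assumes "z ^ N = 1" "N > 0"
  shows "cmod z = 1"
proof -
  have "cmod z ^ N = 1"
    using assms by (metis norm_one norm_power)
  then show ?thesis
    using assms(2) power_eq_imp_eq_base[of "cmod z" N 1] by simp
qed

lemma chord2_bounds:
  assumes "cmod z = 1" "\<bar>e\<bar> \<le> 1"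
  shows "0 \<le> chord2 e z" "chord2 e z \<le> 4"
proof -
  have "\<bar>of_int e * Re z\<bar> \<le> 1 * 1"
    unfolding abs_mult using assms abs_Re_le_cmod[of z] by (intro mult_mono) auto
  then show "0 \<le> chord2 e z" "chord2 e z \<le> 4"
    by (auto simp: chord2_def abs_le_iff)
qed

lemma chord2_uminus: "chord2 e (- z) = chord2 (- e) z"
  by (simp add: chord2_def)

lemma chord2_uminus_right: "chord2 1 (- z) = 4 - chord2 1 z"
  by (simp add: chord2_def)

lemma chord2_square:
  assumes "cmod z = 1"
  shows "chord2 1 (z\<^sup>2) = dbl (chord2 1 z)" "chord2 (- 1) (z\<^sup>2) = dbl' (chord2 (- 1) z)"
proof -
  have "(Im z)\<^sup>2 = 1 - (Re z)\<^sup>2"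
    using assms by (metis cmod_power2 one_power2 add_diff_cancel_left')
  then show "chord2 1 (z\<^sup>2) = dbl (chord2 1 z)" "chord2 (- 1) (z\<^sup>2) = dbl' (chord2 (- 1) z)"
    by (simp_all add: chord2_def dbl_def dbl'_def Re_power2) (simp_all add: power2_eq_square algebra_simps)
qed

lemma chord2_power_of_two:
  assumes "cmod z = 1"
  shows "(dbl ^^ i) (chord2 1 z) = chord2 1 (z ^ 2 ^ i)" "(dbl' ^^ i) (chord2 (- 1) z) = chord2 (- 1) (z ^ 2 ^ i)"
proof -
  have "z ^ 2 ^ Suc i = (z ^ 2 ^ i)\<^sup>2" "cmod (z ^ 2 ^ i) = 1" for i
    using assms by (simp_all add: power_mult[symmetric] mult.commute norm_power)
  then show "(dbl ^^ i) (chord2 1 z) = chord2 1 (z ^ 2 ^ i)" "(dbl' ^^ i) (chord2 (- 1) z) = chord2 (- 1) (z ^ 2 ^ i)"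
    by (induction i) (simp_all add: chord2_square del: power_Suc)
qed

section \<open>Chords as values of integer polynomials\<close>

lemma common_root_of_unity:
  fixes N :: nat
  assumes "N > 0"
  obtains x :: complex where "x ^ N = 1" "\<And>z. z ^ N = 1 \<Longrightarrow> \<exists>a. z = x ^ a"
proof (rule that[of "cis (2 * pi / N)"])
  show "cis (2 * pi / N) ^ N = 1"
    using assms by (simp add: DeMoivre)
  show "\<exists>a. z = cis (2 * pi / N) ^ a" if "z ^ N = 1" for z
  proof -
    have "z \<in> (\<lambda>k. cis (2 * pi * real k / real N)) ` {..<N}"
      using bij_betw_roots_unity[OF assms] that by (simp add: bij_betw_def)
    then show ?thesis
      by (auto simp: DeMoivre mult_ac)
  qed
qed

lemma cnj_root_of_unity:
  assumes "z ^ N = 1" "N > 0"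
  shows "cnj z = z ^ (N - 1)"
proof -
  have "z * cnj z = 1"
    using norm_root_of_unity[OF assms] by (simp add: complex_norm_square[symmetric])
  moreover have "z * z ^ (N - 1) = 1"
    using assms by (metis power_minus_mult mult.commute)
  ultimately show ?thesis
    by (metis mult_cancel_left mult_zero_left zero_neq_one)
qed

text \<open>The exponent \<open>a * (N - 1)\<close> encodes the complex conjugate of
  \<open>x^a\<close>, since conjugation inverts an \<open>N\<close>-th root of unity.\<close>

definition chord2_poly :: "nat \<Rightarrow> int \<Rightarrow> nat \<Rightarrow> int poly" where
  "chord2_poly N e a = [:2:] - smult e (monom 1 a + monom 1 (a * (N - 1)))"

lemma ipoly_chord2_poly:
  assumes "x ^ N = 1" "N > 0"
  shows "ipoly (chord2_poly N e a) x = complex_of_real (chord2 e (x ^ a))"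
proof -
  have "(x ^ a) ^ N = 1"
    using assms(1) by (metis mult.commute power_mult power_one)
  then have "cnj (x ^ a) = x ^ (a * (N - 1))"
    using cnj_root_of_unity[of "x ^ a" N] assms(2) by (simp add: power_mult)
  then have "x ^ a + x ^ (a * (N - 1)) = complex_of_real (2 * Re (x ^ a))"
    by (metis complex_add_cnj)
  then show ?thesis
    by (simp add: chord2_poly_def chord2_def)
qed

text \<open>Conjugation can be undone: with \<open>j\<close> inverse to \<open>k\<close> modulo
  \<open>N\<close>, \<open>z = (z^k)^j\<close>.\<close>

lemma chord2_power_eq_0_imp:
  assumes z: "z ^ N = 1" and N: "N > 0" and k: "coprime k N" and 0: "chord2 e (z ^ k) = 0"
  shows "chord2 e z = 0"
\<comment> \<open>For \<open>N = 1\<close> the exponent 0 is coprime to \<open>N\<close>; there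
  \<open>z = 1\<close>.\<close>
proof (cases "N = 1")
  case False
  then have "k \<noteq> 0"
    using k by (metis coprime_0_left_iff nat_dvd_1_iff_1)
  then obtain j m where jm: "k * j = N * m + 1"
    using bezout_nat[of k N] k by auto
  have "j > 0"
    using jm by (intro Nat.gr0I) simp
  moreover have "coprime j N"
  proof (rule coprimeI)
    fix d
    assume "d dvd j" "d dvd N"
    then have "d dvd N * m + 1" "d dvd N * m"
      unfolding jm[symmetric] by simp_all
    then show "d dvd 1"
      using dvd_add_right_iff by blast
  qed
  ultimately have j: "j > 0" "coprime j N"
    by simp_all
  have zk: "(z ^ k) ^ N = 1"
    using z by (metis mult.commute power_mult power_one)
  have "ipoly (chord2_poly N e 1) (z ^ k) = 0"
    using 0 by (subst ipoly_chord2_poly[OF zk N]) simp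
  then have "ipoly (chord2_poly N e 1) ((z ^ k) ^ j) = 0"
    using ipoly_root_of_unity_power[OF zk N] j by blast
  also have "(z ^ k) ^ j = z"
    using z by (simp add: power_mult[symmetric] jm power_add) (simp add: power_mult)
  finally show ?thesis
    by (subst (asm) ipoly_chord2_poly[OF z N]) simp
qed (use z 0 in simp)

text \<open>Both \<open>z\<close> and \<open>w\<close> are powers of one \<open>x\<close>, so the
  equation with the denominator of \<open>s\<close> cleared says that one integer polynomial
  vanishes at \<open>x\<close>. Positivity is not algebraic; it survives because chords are
  nonnegative and a conjugate of a nonzero chord is nonzero.\<close>

lemma rel_chord2_power:
  assumes z: "z ^ N = 1" and w: "w ^ N = 1" and N: "N > 0" and k: "coprime k N" "k > 0"
    and s: "s \<in> \<rat>" and ef: "\<bar>e\<bar> \<le> 1" "\<bar>f\<bar> \<le> 1"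
    and rel: "rel s (chord2 e z) (chord2 f w)"
  shows "rel s (chord2 e (z ^ k)) (chord2 f (w ^ k))"
proof -
  obtain x :: complex where x: "x ^ N = 1" "\<And>z. z ^ N = 1 \<Longrightarrow> \<exists>a. z = x ^ a"
    using common_root_of_unity[OF N] by blast
  obtain a b where ab: "z = x ^ a" "w = x ^ b"
    using x(2) z w by blast
  obtain p q where pq: "q \<noteq> 0" "s = of_int p / of_int q"
    using s by (metis Rats_cases' of_int_0_less_iff less_irrefl)
  let ?A = "chord2_poly N e a" and ?B = "chord2_poly N f b"
  define h where "h = smult q (?A\<^sup>2 + ?B\<^sup>2) - smult p (?A * ?B)"
  have h: "ipoly h y = complex_of_real (of_int q * ((chord2 e (y ^ a))\<^sup>2 + (chord2 f (y ^ b))\<^sup>2 - s * chord2 e (y ^ a) * chord2 f (y ^ b)))"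
    if "y ^ N = 1" for y
    using pq(1) unfolding h_def ipoly_diff ipoly_smult ipoly_add ipoly_mult ipoly_power ipoly_chord2_poly[OF that N]
    by (simp add: pq(2) field_simps)
  have "ipoly h x = 0"
    using rel unfolding h[OF x(1)] by (simp add: rel_def ab)
  then have "ipoly h (x ^ k) = 0"
    using ipoly_root_of_unity_power x(1) N k by blast
  moreover have "(x ^ k) ^ N = 1"
    using x(1) by (metis mult.commute power_mult power_one)
  moreover have "(x ^ k) ^ a = z ^ k" "(x ^ k) ^ b = w ^ k"
    by (simp_all add: ab power_mult[symmetric] mult.commute)
  ultimately have "complex_of_real (of_int q * ((chord2 e (z ^ k))\<^sup>2 + (chord2 f (w ^ k))\<^sup>2 - s * chord2 e (z ^ k) * chord2 f (w ^ k))) = 0"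
    using h by metis
  then have "(chord2 e (z ^ k))\<^sup>2 + (chord2 f (w ^ k))\<^sup>2 = s * chord2 e (z ^ k) * chord2 f (w ^ k)"
    using pq(1) by (simp only: of_real_eq_0_iff mult_eq_0_iff of_int_eq_0_iff) auto
  moreover have "chord2 e (z ^ k) > 0"
  proof -
    have "cmod (z ^ k) = 1"
      using norm_root_of_unity[OF z N] by (simp add: norm_power)
    moreover have "chord2 e (z ^ k) \<noteq> 0"
      using chord2_power_eq_0_imp[OF z N k(1)] rel by (auto simp: rel_def)
    ultimately show ?thesis
      using chord2_bounds(1)[of "z ^ k" e] ef by simp
  qed
  moreover have "chord2 f (w ^ k) > 0"
  proof -
    have "cmod (w ^ k) = 1"
      using norm_root_of_unity[OF w N] by (simp add: norm_power)
    moreover have "chord2 f (w ^ k) \<noteq> 0"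
      using chord2_power_eq_0_imp[OF w N k(1)] rel by (auto simp: rel_def)
    ultimately show ?thesis
      using chord2_bounds(1)[of "w ^ k" f] ef by simp
  qed
  ultimately show ?thesis
    by (simp add: rel_def)
qed


lemma Rats_of_real_ipoly_imp_Ints:
  assumes "x ^ N = 1" "N > 0" "ipoly h x = complex_of_real t" "t \<in> \<rat>"
  shows "t \<in> \<int>"
proof -
  have "ipoly h x \<in> \<rat>"
    using assms(4) unfolding assms(3) by (auto elim!: Rats_cases' simp: of_real_divide)
  then have "ipoly h x \<in> \<int>"
    by (rule Rats_ipoly_imp_Ints[OF algebraic_int_root_of_unity[OF assms(1,2)]])
  then show ?thesis
    unfolding assms(3) by (metis Ints_cases Ints_of_int of_real_of_int_eq of_real_eq_iff)
qed

lemma Rats_chord2_imp_Ints: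
  assumes "z ^ N = 1" "N > 0" "chord2 e z \<in> \<rat>"
  shows "chord2 e z \<in> \<int>"
  using ipoly_chord2_poly[OF assms(1,2), of e 1] assms
  by (intro Rats_of_real_ipoly_imp_Ints[OF assms(1,2)]) simp_all

lemma rel_chord2_imp_odd:
  assumes z: "z ^ M = 1" and w: "w ^ M = 1" and M: "odd M"
    and s: "s \<in> \<rat>" and ef: "e \<in> {0, 1, - 1}" "f \<in> {0, 1, - 1}"
    and rel: "rel s (chord2 e z) (chord2 f w)"
  shows "rel s (chord2 e (z ^ 2 ^ i)) (chord2 f (w ^ 2 ^ i))"
  using M ef by (intro rel_chord2_power[OF z w _ _ _ s _ _ rel]) (auto intro: odd_pos)

text \<open>For \<open>u\<close> of odd order and \<open>u\<close> not 1, the inverse of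
  \<open>1 + u\<close> is \<open>1 + u^2 + u^4 + ... + u^(M - 1)\<close>: multiplied by
  \<open>1 - u^2\<close> the sum telescopes to \<open>1 - u^(M + 1) = 1 - u\<close>. The chord is
  the product of \<open>1 + v\<close> and its conjugate.\<close>

lemma inverse_chord2_odd:
  assumes x: "x ^ M = 1" and M: "odd M" and v: "x ^ b \<noteq> 1"
  obtains h where "ipoly h x = complex_of_real (1 / chord2 (- 1) (x ^ b))"
proof -
  have "M > 0"
    using M by (simp add: odd_pos)
  let ?v = "x ^ b"
  define m where "m = Suc M div 2"
  have vM: "?v ^ M = 1"
    using x by (metis mult.commute power_mult power_one)
  have m: "2 * m = Suc M"
    using M by (simp add: m_def)
  define g :: "nat \<Rightarrow> int poly" where "g a = (\<Sum>j<m. monom 1 (a * (2 * j)))" for a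
  have ipoly_sum: "ipoly (sum p A) x = (\<Sum>j\<in>A. ipoly (p j) x)" for p :: "nat \<Rightarrow> int poly" and A
    by (induction A rule: infinite_finite_induct) simp_all
  have inv: "(1 + u) * (\<Sum>j<m. u ^ (2 * j)) = 1" if "u ^ M = 1" "u \<noteq> 1" for u :: complex
  proof -
    have "(1 - u) * ((1 + u) * (\<Sum>j<m. u ^ (2 * j))) = (1 - u\<^sup>2) * (\<Sum>j<m. (u\<^sup>2) ^ j)"
      by (simp add: power_mult power2_eq_square algebra_simps)
    also have "\<dots> = 1 - (u\<^sup>2) ^ m"
      by (rule one_diff_power_eq[symmetric])
    also have "\<dots> = 1 - u"
      using that(1) by (simp add: power_mult[symmetric] m)
    finally show ?thesis
      using that(2) by (metis eq_iff_diff_eq_0 mult_cancel_left mult_cancel_left1)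
  qed
  have cnj: "cnj ?v = x ^ (b * (M - 1))"
    using cnj_root_of_unity[OF vM \<open>M > 0\<close>] by (simp add: power_mult)
  have g: "(1 + x ^ a) * ipoly (g a) x = 1" if "x ^ a \<noteq> 1" for a
  proof -
    have "(x ^ a) ^ M = 1"
      using x by (metis mult.commute power_mult power_one)
    from inv[OF this that] show ?thesis
      by (simp add: g_def ipoly_sum power_mult)
  qed
  have 1: "(1 + ?v) * ipoly (g b) x = 1"
    using g v by blast
  have "x ^ (b * (M - 1)) \<noteq> 1"
    using v by (metis cnj complex_cnj_one complex_cnj_cnj)
  then have 2: "(1 + cnj ?v) * ipoly (g (b * (M - 1))) x = 1"
    using g cnj by metis
  have "?v * cnj ?v = 1"
    using norm_root_of_unity[OF vM \<open>M > 0\<close>] complex_norm_square[of ?v] by simp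
  then have 3: "complex_of_real (chord2 (- 1) ?v) = (1 + ?v) * (1 + cnj ?v)"
    using complex_add_cnj[of ?v] by (simp add: chord2_def algebra_simps)
  have "ipoly (g b * g (b * (M - 1))) x * complex_of_real (chord2 (- 1) ?v)
      = ((1 + ?v) * ipoly (g b) x) * ((1 + cnj ?v) * ipoly (g (b * (M - 1))) x)"
    unfolding ipoly_mult 3 by (simp only: mult_ac)
  also have "\<dots> = 1"
    unfolding 1 2 by simp
  finally have eq: "ipoly (g b * g (b * (M - 1))) x * complex_of_real (chord2 (- 1) ?v) = 1" .
  then have nz: "complex_of_real (chord2 (- 1) ?v) \<noteq> 0"
    by (metis mult_zero_right zero_neq_one)
  have "ipoly (g b * g (b * (M - 1))) x = complex_of_real (1 / chord2 (- 1) ?v)"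
    unfolding of_real_divide of_real_1 using eq nonzero_eq_divide_eq[OF nz] by blast
  then show thesis
    using that by blast
qed

text \<open>
  Since |1 + w|^2 is a unit, the ratio of the pair and its inverse (the ratio of the conjugate pair)
  are both algebraic integers.
\<close>

lemma flip_imp_Ints:
  assumes z: "z ^ M = 1" and w: "w ^ M = 1" and M: "odd M" and s: "s \<in> \<rat>" "s \<noteq> 2"
    and w1: "w \<noteq> 1" and rel: "rel s (chord2 1 z) (chord2 (- 1) w)"
    and flip: "chord2 1 z * chord2 1 (z\<^sup>2) = chord2 (- 1) w * chord2 (- 1) (w\<^sup>2)"
  shows "s \<in> \<int> \<and> chord2 1 z / chord2 (- 1) w \<notin> \<rat>"
proof -
  have "M > 0"
    using M by (simp add: odd_pos)
  obtain x :: complex where x: "x ^ M = 1" "\<And>z. z ^ M = 1 \<Longrightarrow> \<exists>a. z = x ^ a"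
    using common_root_of_unity[OF \<open>M > 0\<close>] by blast
  obtain a b where ab: "z = x ^ a" "w = x ^ b"
    using x(2) z w by blast
  define r where "r = chord2 1 z / chord2 (- 1) w"
  have pos: "chord2 1 z > 0" "chord2 (- 1) w > 0"
    using rel by (auto simp: rel_def)
  have rel2: "rel s (chord2 1 (z\<^sup>2)) (chord2 (- 1) (w\<^sup>2))"
    using rel_chord2_imp_odd[OF z w M s(1) _ _ rel, of 1] by simp
  then have pos2: "chord2 1 (z\<^sup>2) > 0" "chord2 (- 1) (w\<^sup>2) > 0"
    by (auto simp: rel_def)
  have r_inv: "1 / r = chord2 1 (z\<^sup>2) / chord2 (- 1) (w\<^sup>2)"
    using flip pos pos2 by (simp add: r_def field_simps)
  have quot: "\<exists>h. ipoly h x = complex_of_real (chord2 1 (x ^ i) / chord2 (- 1) (x ^ j))" if xj: "x ^ j \<noteq> 1" for i j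
  proof -
    obtain h where "ipoly h x = complex_of_real (1 / chord2 (- 1) (x ^ j))"
      using inverse_chord2_odd[OF x(1) M xj] .
    then have "ipoly (chord2_poly M 1 i * h) x = complex_of_real (chord2 1 (x ^ i) / chord2 (- 1) (x ^ j))"
      using ipoly_chord2_poly[OF x(1) \<open>M > 0\<close>] by simp
    then show ?thesis ..
  qed
  obtain h1 where h1: "ipoly h1 x = complex_of_real r"
    using quot[of b a] w1 unfolding r_def ab by blast
  have "w\<^sup>2 \<noteq> 1"
  proof
    assume "w\<^sup>2 = 1"
    then have "w ^ M = w"
      using M by (metis oddE power_add power_mult power_one mult_1 power_one_right)
    then show False
      using w w1 by simp
  qed
  then obtain h2 where h2: "ipoly h2 x = complex_of_real (1 / r)"
    using quot[of "b * 2" "a * 2"] unfolding r_inv ab by (auto simp: power_mult)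
  have rats: "t \<in> \<int>" if "t \<in> \<rat>" "ipoly h x = complex_of_real t" for h t
    using Rats_of_real_ipoly_imp_Ints[OF x(1) \<open>M > 0\<close>] that by blast
  have "r > 0" "r\<^sup>2 = s * r - 1"
    using rel_ratio[OF rel] unfolding r_def by auto
  then have sr: "s = r + 1 / r"
    by (simp add: field_simps power2_eq_square)
  then have "ipoly (h1 + h2) x = complex_of_real s"
    using h1 h2 by simp
  then have "s \<in> \<int>"
    using rats s(1) by blast
  moreover have "r \<notin> \<rat>"
  proof
    assume "r \<in> \<rat>"
    then have "r \<in> \<int>" "1 / r \<in> \<int>"
      using rats h1 h2 by (metis Rats_1 Rats_divide)+
    then obtain m n where mn: "r = of_int m" "1 / r = of_int n"
      by (metis Ints_cases)
    then have "of_int m * of_int n = (1 :: real)"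
      using \<open>r > 0\<close> by (metis less_irrefl nonzero_mult_div_cancel_left times_divide_eq_right mult.right_neutral)
    then have "m * n = 1"
      by (metis of_int_mult of_int_eq_1_iff)
    then have "m = 1"
      using \<open>r > 0\<close> mn(1) by (auto simp: zmult_eq_1_iff)
    then show False
      using sr mn(1) s(2) by simp
  qed
  ultimately show ?thesis
    unfolding r_def by blast
qed

section \<open>The possible traces\<close>

text \<open>
  The values of y^2 + 2 for y in the list of the theorem.
\<close>

definition ratio_traces :: "real set" where
  "ratio_traces = {2, 3, 17/4, 6, 4, 7, 14, 5/2, 13/6, 10/3, 25/12}"

lemma rel_chord2_odd:
  assumes z: "z ^ M = 1" and w: "w ^ M = 1" and M: "odd M" and s: "s \<in> \<rat>"
    and ef: "e \<in> {1, - 1}" "f \<in> {1, - 1}" and rel: "rel s (chord2 e z) (chord2 f w)"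
  shows "s \<in> ratio_traces"
proof -
  have norm: "cmod u = 1" if "u ^ M = 1" for u
    using norm_root_of_unity[OF that] M by (simp add: odd_pos)
  have mixed: "s \<in> ratio_traces"
    if z: "z ^ M = 1" and w: "w ^ M = 1" and rel: "rel s (chord2 1 z) (chord2 (- 1) w)" for z w
  \<comment> \<open>At \<open>w = 1\<close> the number \<open>|1 + w|^2 = 4\<close> is not a unit,
    so the integrality argument does not apply.\<close>
  proof (cases "w = 1")
    case True
    have "rel s (dbl (chord2 1 z)) 4"
      using rel_chord2_imp_odd[OF z w M s _ _ rel, of 1] True chord2_square[OF norm[OF z]]
      by (simp add: chord2_def[of _ 1])
    moreover have "rel s (chord2 1 z) 4"
      using rel True by (simp add: chord2_def[of _ 1])
    ultimately show ?thesis
      using rel_4_dbl by (auto simp: ratio_traces_def)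
  next
    case False
    have reli: "rel s (chord2 1 (z ^ 2 ^ i)) (chord2 (- 1) (w ^ 2 ^ i))" for i
      using rel_chord2_imp_odd[OF z w M s _ _ rel] by simp
    have "s \<in> {2, 10/3, 25/12}"
    proof (rule rel_dbl_dbl'_mixed[OF s])
      show "rel s ((dbl ^^ i) (chord2 1 z)) ((dbl' ^^ i) (chord2 (- 1) w))" for i
        using reli by (simp add: chord2_power_of_two norm z w)
      fix i
      assume flip: "(dbl ^^ i) (chord2 1 z) * (dbl ^^ Suc i) (chord2 1 z) =
        (dbl' ^^ i) (chord2 (- 1) w) * (dbl' ^^ Suc i) (chord2 (- 1) w)" and "s \<noteq> 2"
      have sq: "u ^ 2 ^ Suc i = (u ^ 2 ^ i)\<^sup>2" for u :: complex
        by (simp add: power_mult[symmetric] mult.commute)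
      have unit: "(u ^ 2 ^ i) ^ M = 1" if "u ^ M = 1" for u :: complex
        using that by (metis mult.commute power_mult power_one)
      have "w ^ 2 ^ i \<noteq> 1"
      proof
        assume "w ^ 2 ^ i = 1"
        have "coprime (2 ^ i) M"
          using M by simp
        then have "chord2 1 w = 0"
          by (rule chord2_power_eq_0_imp[OF w odd_pos[OF M]]) (simp add: \<open>w ^ 2 ^ i = 1\<close> chord2_def)
        then have "w = 1"
          using norm_one_minus_power2[OF norm[OF w]] by simp
        then show False
          using False by simp
      qed
      from flip_imp_Ints[OF unit[OF z] unit[OF w] M s \<open>s \<noteq> 2\<close> this reli] flip
      show "s \<in> \<int> \<and> (dbl ^^ i) (chord2 1 z) / (dbl' ^^ i) (chord2 (- 1) w) \<notin> \<rat>"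
        unfolding chord2_power_of_two[OF norm[OF z]] chord2_power_of_two[OF norm[OF w]] sq by blast
    qed
    then show ?thesis
      by (auto simp: ratio_traces_def)
  qed
  have levels: "rel s (chord2 e (z ^ 2 ^ i)) (chord2 f (w ^ 2 ^ i))" for i
    using rel_chord2_imp_odd[OF z w M s _ _ rel] ef by blast
  consider "e = 1" "f = 1" | "e = - 1" "f = - 1" | "e = 1" "f = - 1" | "e = - 1" "f = 1"
    using ef by blast
  then show ?thesis
  proof cases
    case 1
    have "rel s ((dbl ^^ i) (chord2 1 z)) ((dbl ^^ i) (chord2 1 w))" for i
      using levels[of i] 1 by (simp add: chord2_power_of_two norm z w)
    from this[of 0] this[of 1] this[of 2] show ?thesis
      using rel_dbl_dbl[of s "chord2 1 z" "chord2 1 w"] by (auto simp: ratio_traces_def numeral_2_eq_2)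
  next
    case 2
    have "rel s ((dbl' ^^ i) (chord2 (- 1) z)) ((dbl' ^^ i) (chord2 (- 1) w))" for i
      using levels[of i] 2 by (simp add: chord2_power_of_two norm z w)
    from this[of 0] this[of 1] this[of 2] this[of 3] show ?thesis
      using rel_dbl'_dbl'[OF s, of "chord2 (- 1) z" "chord2 (- 1) w"]
      by (auto simp: ratio_traces_def numeral_2_eq_2 numeral_3_eq_3)
  next
    case 3
    then show ?thesis
      using mixed z w rel by blast
  next
    case 4
    then show ?thesis
      using mixed z w rel_sym[OF rel] by blast
  qed
qed

lemma odd_root_of_unity_or_uminus:
  fixes z :: complex
  assumes "z ^ (2 * M) = 1" "odd M"
  obtains e u where "e \<in> {1, - 1}" "u ^ M = 1" "chord2 1 z = chord2 e u"
proof -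
  have "(z ^ M)\<^sup>2 = 1"
    using assms(1) by (metis mult.commute power_mult)
  then have "z ^ M = 1 \<or> z ^ M = - 1"
    by (simp add: power2_eq_1_iff)
  then show thesis
  proof
    assume "z ^ M = 1"
    then show thesis
      using that[of 1 z] by simp
  next
    assume "z ^ M = - 1"
    then have "(- z) ^ M = 1"
      using assms(2) by (simp add: power_minus_odd)
    then show thesis
      using that[of "- 1" "- z"] by (simp add: chord2_uminus)
  qed
qed

lemma rel_2_chord2:
  assumes w: "w ^ (2 * M) = 1" and M: "odd M" and s: "s \<in> \<rat>" and rel: "rel s 2 (chord2 1 w)"
  shows "s \<in> ratio_traces"
proof -
  obtain e u where u: "e \<in> {1, - 1}" "u ^ M = 1" "chord2 1 w = chord2 e u"
    using odd_root_of_unity_or_uminus[OF w M] .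
  have norm: "cmod u = 1"
    using norm_root_of_unity[OF u(2)] M by (simp add: odd_pos)
  \<comment> \<open>Writing the constant 2 as \<open>chord2 0 u\<close> makes it half of a conjugate
    pair on which the power maps act trivially.\<close>
  have "rel s (chord2 0 u) (chord2 e u)"
    using rel u by (simp add: chord2_def[of 0])
  from rel_chord2_imp_odd[OF u(2,2) M s _ _ this]
  have levels: "rel s 2 (chord2 e (u ^ 2 ^ i))" for i
    using u(1) by (simp add: chord2_def[of 0])
  from u(1) consider "e = 1" | "e = - 1"
    by blast
  then show ?thesis
  proof cases
    case 1
    have "rel s 2 ((dbl ^^ i) (chord2 1 u))" for i
      using levels[of i] 1 by (simp add: chord2_power_of_two norm)
    from this[of 0] this[of 1] this[of 2] show ?thesis
      using rel_2_dbl[of s "chord2 1 u"] by (auto simp: ratio_traces_def numeral_2_eq_2)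
  next
    case 2
    have "rel s 2 ((dbl' ^^ i) (chord2 (- 1) u))" for i
      using levels[of i] 2 by (simp add: chord2_power_of_two norm)
    from this[of 0] this[of 1] this[of 2] show ?thesis
      using rel_2_dbl'[of s "chord2 (- 1) u"] by (auto simp: ratio_traces_def numeral_2_eq_2)
  qed
qed

lemma Ints_between_0_4:
  assumes "x \<in> \<int>" "0 < (x :: real)" "x \<le> 4"
  shows "x \<in> {1, 2, 3, 4}"
proof -
  obtain n where n: "x = of_int n"
    using assms(1) by (rule Ints_cases)
  then have "n \<in> {1, 2, 3, 4}"
    using assms(2,3) by auto
  then show ?thesis
    using n by auto
qed

text \<open>Subtracting the relations for \<open>a\<close> and \<open>4 - a\<close> gives
  \<open>(2 - a) * (4 - s * b) = 0\<close>. Either \<open>z\<close> is \<open>i\<close> or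
  \<open>-i\<close>, or \<open>b = 4 / s\<close> is a rational chord and hence one of 1, 2, 3,
  4.\<close>

lemma rel_chord2_one_sign:
  assumes z: "z ^ N = 1" and w: "w ^ N = 1" and N: "4 dvd N" "N > 0" and s: "s \<in> \<rat>"
    and rel: "rel s (chord2 1 z) (chord2 1 w)"
    and half: "z ^ (N div 2) = - 1" "w ^ (N div 2) = 1"
    and rel': "rel s (4 - chord2 1 z) (chord2 1 w)"
  shows "s \<in> ratio_traces"
proof -
  define a b where "a = chord2 1 z" and "b = chord2 1 w"
  have r: "rel s a b" "rel s (4 - a) b"
    using rel rel' by (simp_all add: a_def b_def)
  have "(2 - a) * (4 - s * b) = 0"
    using r by (simp add: rel_def power2_eq_square algebra_simps)
  then consider "a = 2" | "s * b = 4"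
    by fastforce
  then show ?thesis
  proof cases
    case 1
    then have "Re z = 0"
      by (simp add: a_def chord2_def)
    moreover have "(Re z)\<^sup>2 + (Im z)\<^sup>2 = 1"
      using norm_root_of_unity[OF z N(2)] by (metis cmod_power2 one_power2)
    ultimately have "z\<^sup>2 = - 1"
      by (simp add: complex_eq_iff Re_power2 Im_power2)
    \<comment> \<open>From \<open>z^2 = -1\<close> and \<open>z^(2 * q) = -1\<close> it follows that
      \<open>q\<close> is odd, and \<open>w^(2 * q) = 1\<close>; this is the situation of
      \<open>rel_2_chord2\<close>.\<close>
    obtain q where q: "N = 4 * q"
      using N(1) ..
    have "(- 1 :: complex) ^ q = (z\<^sup>2) ^ q"
      by (simp add: \<open>z\<^sup>2 = - 1\<close>)
    also have "\<dots> = - 1"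
      using half(1) by (simp add: q power_mult[symmetric])
    finally have "odd q"
      by (metis neg_one_even_power one_neq_neg_one)
    moreover have "w ^ (2 * q) = 1"
      using half(2) by (simp add: q)
    ultimately show ?thesis
      using rel_2_chord2 s r(1) 1 unfolding b_def by blast
  next
    case 2
    then have "s > 0"
      using rel_ge_2[OF r(1)] by simp
    then have b: "b = 4 / s"
      using 2 by (simp add: field_simps)
    then have "b \<in> \<int>"
      using Rats_chord2_imp_Ints[OF w N(2), of 1] s unfolding b_def by simp
    moreover have "0 < b" "b \<le> 4"
      using r chord2_bounds[OF norm_root_of_unity[OF w N(2)], of 1] by (auto simp: rel_def b_def)
    ultimately have "b \<in> {1, 2, 3, 4}"
      by (rule Ints_between_0_4)
    then show ?thesis
      using 2 rel_ge_2[OF r(1)] by (auto simp: ratio_traces_def)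
  qed
qed

text \<open>Both outcomes lead to \<open>a = b\<close> or \<open>a + b = 4\<close>. In the latter
  case \<open>a * b\<close> is the squared chord of \<open>z^2\<close>, and
  \<open>(s + 2) * a * b = 16\<close> makes it rational, hence one of 1, 2, 3, 4.\<close>

lemma rel_chord2_both_signs:
  assumes z: "z ^ N = 1" and N: "N > 0" and s: "s \<in> \<rat>"
    and rel: "rel s (chord2 1 z) b" and rel': "rel s (4 - chord2 1 z) (4 - b)"
  shows "s \<in> ratio_traces"
proof -
  define a where "a = chord2 1 z"
  have r: "rel s a b" "rel s (4 - a) (4 - b)"
    using rel rel' by (simp_all add: a_def)
  from r have "a = b \<or> a + b = 4"
  proof (cases rule: rel_cases)
    case same
    then show ?thesis
      by (simp add: algebra_simps)
  next
    case flip
    then have "(a - b) * (a + b - 4) = 0"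
      by (simp add: algebra_simps)
    then show ?thesis
      by auto
  qed
  then show ?thesis
  proof
    assume "a = b"
    then show ?thesis
      using rel_same r(1) by (auto simp: ratio_traces_def)
  next
    assume "a + b = 4"
    then have b: "b = 4 - a"
      by simp
    define d where "d = chord2 1 (z\<^sup>2)"
    have norm: "cmod z = 1" "cmod (z\<^sup>2) = 1"
      using norm_root_of_unity[OF z N] by (simp_all add: norm_power)
    have d: "d = a * b"
      using chord2_square(1)[OF norm(1)] by (simp add: d_def a_def b dbl_def)
    have sd: "(s + 2) * d = 16"
      using r(1) by (simp add: rel_def d b power2_eq_square algebra_simps)
    then have "d = 16 / (s + 2)"
      using rel_ge_2[OF r(1)] by (simp add: field_simps)
    moreover have "(z\<^sup>2) ^ N = 1"
      using z by (metis mult.commute power_mult power_one)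
    ultimately have "d \<in> \<int>"
      using Rats_chord2_imp_Ints[of "z\<^sup>2" N 1] N s unfolding d_def by simp
    moreover have "0 < d" "d \<le> 4"
      using r chord2_bounds[OF norm(2), of 1] by (auto simp: rel_def d_def[symmetric] d)
    ultimately have "d \<in> {1, 2, 3, 4}"
      by (rule Ints_between_0_4)
    then show ?thesis
      using sd by (auto simp: ratio_traces_def)
  qed
qed

lemma rel_chord2_ratio_traces:
  assumes "z ^ N = 1" "w ^ N = 1" "N > 0" "s \<in> \<rat>" "rel s (chord2 1 z) (chord2 1 w)"
  shows "s \<in> ratio_traces"
  using assms
proof (induction N rule: less_induct)
  case (less N)
  note z = less.prems(1) and w = less.prems(2) and N = less.prems(3) and s = less.prems(4)
    and rel = less.prems(5)
  have "odd N \<or> (\<exists>M. N = 2 * M \<and> odd M) \<or> 4 dvd N"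
    by presburger
  then consider "odd N" | M where "N = 2 * M" "odd M" | "4 dvd N"
    by blast
  then show ?case
  proof cases
    case 1
    then show ?thesis
      using rel_chord2_odd[OF z w _ s _ _ rel] by simp
  next
    case 2
    obtain e u where u: "e \<in> {1, - 1}" "u ^ M = 1" "chord2 1 z = chord2 e u"
      using odd_root_of_unity_or_uminus z 2 by metis
    obtain f v where v: "f \<in> {1, - 1}" "v ^ M = 1" "chord2 1 w = chord2 f v"
      using odd_root_of_unity_or_uminus w 2 by metis
    show ?thesis
      using rel_chord2_odd[OF u(2) v(2) 2(2) s u(1) v(1)] rel u(3) v(3) by simp
  next
    case 3
    define k where "k = N div 2 + 1"
    have half: "2 * (N div 2) = N" "even (N div 2)"
      using 3 by (auto elim!: dvdE)
    have k: "coprime k N"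
    proof (rule coprimeI)
      fix d
      assume d: "d dvd k" "d dvd N"
      have "2 * k = N + 2"
        using half(1) by (simp add: k_def)
      then have "d dvd N + 2"
        using d(1) by (metis dvd_mult)
      then have "d dvd 2"
        using d(2) dvd_add_right_iff by blast
      moreover have "odd d"
        using d(1) half(2) unfolding k_def by (meson dvd_trans even_add odd_one)
      ultimately have "d \<le> 2" "odd d"
        by (auto dest: dvd_imp_le)
      then have "d = 1"
        by presburger
      then show "d dvd 1"
        by simp
    qed
    then have relk: "rel s (chord2 1 (z ^ k)) (chord2 1 (w ^ k))"
      using rel_chord2_power[OF z w N k _ s _ _ rel] by (auto simp only: k_def abs_one zero_less_Suc Suc_eq_plus1[symmetric])
    have sign: "u ^ (N div 2) = 1 \<or> u ^ (N div 2) = - 1" if "u ^ N = 1" for u :: complex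
    proof -
      have "(u ^ (N div 2))\<^sup>2 = 1"
        using that half(1) by (metis mult.commute power_mult)
      then show ?thesis
        by (simp add: power2_eq_1_iff)
    qed
    have plus: "chord2 1 (u ^ k) = chord2 1 u" if "u ^ (N div 2) = 1" for u
      using that by (simp add: k_def)
    have minus: "chord2 1 (u ^ k) = 4 - chord2 1 u" if "u ^ (N div 2) = - 1" for u
      using that by (simp add: k_def chord2_uminus_right)
    from sign[OF z] sign[OF w] consider
      "z ^ (N div 2) = 1" "w ^ (N div 2) = 1" | "z ^ (N div 2) = - 1" "w ^ (N div 2) = 1"
      | "z ^ (N div 2) = 1" "w ^ (N div 2) = - 1" | "z ^ (N div 2) = - 1" "w ^ (N div 2) = - 1"
      by blast
    then show ?thesis
    proof cases
      \<comment> \<open>Neither number changes, but both roots of unity already have order dividing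
        \<open>N / 2\<close>, so the induction hypothesis applies.\<close>
      case 1
      then show ?thesis
        using less.IH[of "N div 2"] N half(1) s rel by simp
    next
      case 2
      then show ?thesis
        using rel_chord2_one_sign[OF z w 3 N s rel] relk plus minus by simp
    next
      case 3
      then show ?thesis
        using rel_chord2_one_sign[OF w z \<open>4 dvd N\<close> N s rel_sym[OF rel]] rel_sym[OF relk] plus minus by simp
    next
      case 4
      then show ?thesis
        using rel_chord2_both_signs[OF z N s rel] relk minus by simp
    qed
  qed
qed

section \<open>Diagonals of regular polygons\<close>

lemma of_real_Rats_complex_iff: "complex_of_real x \<in> \<rat> \<longleftrightarrow> x \<in> \<rat>"
proof
  assume "complex_of_real x \<in> \<rat>"
  then obtain a b where "b > 0" "complex_of_real x = of_int a / of_int b"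
    by (rule Rats_cases')
  then have "complex_of_real x = complex_of_real (of_int a / of_int b)"
    by simp
  then have "x = of_int a / of_int b"
    by (simp only: of_real_eq_iff)
  then show "x \<in> \<rat>"
    by simp
qed (auto elim!: Rats_cases' simp: of_real_divide)

text \<open>Rotation by the inverse of \<open>a\<close> moves a chord from \<open>a\<close> to
  \<open>b\<close> to one starting at 1, without changing its length.\<close>

lemma diagonals_root_of_unity_image:
  assumes "N > 0"
  shows "diagonals ((\<lambda>z. c + w * z) ` {z. z ^ N = 1}) = {cmod w * cmod (1 - z) | z. z ^ N = 1 \<and> w \<noteq> 0 \<and> z \<noteq> 1}"
    (is "?L = ?R")
proof
  show "?L \<subseteq> ?R"
  proof
    fix d
    assume "d \<in> ?L"
    then obtain a b where ab: "a ^ N = 1" "b ^ N = 1" "c + w * a \<noteq> c + w * b" "d = dist (c + w * a) (c + w * b)"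
      by (auto simp: diagonals_def)
    have "a \<noteq> 0"
      using ab(1) assms by (auto simp: power_0_left)
    have "d = cmod (w * (a * (1 - b / a)))"
      using \<open>a \<noteq> 0\<close> by (simp add: ab(4) dist_norm algebra_simps)
    also have "\<dots> = cmod w * cmod (1 - b / a)"
      using norm_root_of_unity[OF ab(1) assms] by (simp only: norm_mult mult_1)
    finally show "d \<in> ?R"
      using ab(1-3) by (auto simp: power_divide intro!: exI[of _ "b / a"])
  qed
  show "?R \<subseteq> ?L"
  proof
    fix d
    assume "d \<in> ?R"
    then obtain z where z: "z ^ N = 1" "w \<noteq> 0" "z \<noteq> 1" "d = cmod w * cmod (1 - z)"
      by blast
    have "d = dist (c + w * 1) (c + w * z)"
      using z(4) by (simp add: dist_norm norm_mult[symmetric] algebra_simps)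
    moreover have "c + w * 1 \<noteq> c + w * z"
      using z by auto
    ultimately show "d \<in> ?L"
      unfolding diagonals_def using z(1) by (blast intro: power_one)
  qed
qed

lemma ratio_of_polygon_diagonals_iff:
  "ratio_of_polygon_diagonals x \<longleftrightarrow>
    (\<exists>N z w. N \<ge> 3 \<and> z ^ N = 1 \<and> w ^ N = 1 \<and> z \<noteq> 1 \<and> w \<noteq> 1 \<and> x = complex_of_real (cmod (1 - z) / cmod (1 - w)))"
  (is "?L \<longleftrightarrow> ?R")
proof
  assume ?L
  then obtain N c u d1 d2 where *: "N \<ge> 3" "u \<noteq> 0" "x = complex_of_real (d1 / d2)"
    "d1 \<in> diagonals ((\<lambda>z. c + u * z) ` {z. z ^ N = 1})" "d2 \<in> diagonals ((\<lambda>z. c + u * z) ` {z. z ^ N = 1})"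
    unfolding ratio_of_polygon_diagonals_def regular_polygon_def by blast
  have "N > 0"
    using *(1) by simp
  from * obtain z w where "d1 = cmod u * cmod (1 - z)" "z ^ N = 1" "z \<noteq> 1"
    "d2 = cmod u * cmod (1 - w)" "w ^ N = 1" "w \<noteq> 1"
    unfolding diagonals_root_of_unity_image[OF \<open>N > 0\<close>] by blast
  then show ?R
    using * by auto
next
  assume ?R
  then obtain N z w where *: "N \<ge> 3" "z ^ N = 1" "w ^ N = 1" "z \<noteq> 1" "w \<noteq> 1"
    "x = complex_of_real (cmod (1 - z) / cmod (1 - w))"
    by blast
  have N: "N > 0"
    using *(1) by simp
  define P where "P = (\<lambda>z. 0 + 1 * z :: complex) ` {z. z ^ N = 1}"
  have "regular_polygon N P"
    unfolding regular_polygon_def P_def using *(1) by (intro conjI exI[of _ 0] exI[of _ 1]) auto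
  moreover have "cmod (1 - z) \<in> diagonals P" "cmod (1 - w) \<in> diagonals P"
    unfolding P_def diagonals_root_of_unity_image[OF N] using *(2-5) by auto
  ultimately show ?L
    unfolding ratio_of_polygon_diagonals_def using *(6) by blast
qed

lemma square_plus_2_mem_ratio_traces_iff:
  fixes y :: real
  shows "y\<^sup>2 + 2 \<in> ratio_traces \<longleftrightarrow> y \<in> {0, 1, -1, 3/2, -(3/2), 2, -2,
       sqrt 2, -sqrt 2, sqrt 5, -sqrt 5, sqrt 12, -sqrt 12,
       sqrt 2 / 2, -(sqrt 2 / 2), sqrt 6 / 6, -(sqrt 6 / 6),
       2 * sqrt 3 / 3, -(2 * sqrt 3 / 3), sqrt 12 / 12, -(sqrt 12 / 12)}" (is "_ \<longleftrightarrow> y \<in> ?S")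
proof -
  have "y\<^sup>2 + 2 \<in> ratio_traces \<longleftrightarrow> y\<^sup>2 \<in> (\<lambda>c. c\<^sup>2) `
    {0, 1, 3/2, 2, sqrt 2, sqrt 5, sqrt 12, sqrt 2 / 2, sqrt 6 / 6, 2 * sqrt 3 / 3, sqrt 12 / 12}"
    by (auto simp: ratio_traces_def power_divide power_mult_distrib)
  also have "\<dots> \<longleftrightarrow> y \<in> ?S"
    unfolding image_iff bex_simps power2_eq_iff by (simp only: insert_iff empty_iff minus_zero) blast
  finally show ?thesis .
qed

section \<open>Realization of all listed values\<close>

lemma root_of_unity_12:
  assumes "c \<in> {1, 1 / 2, 0, sqrt 3 / 2, - 1, - (1 / 2), - (sqrt 3 / 2)}"
  shows "\<exists>z. z ^ 12 = 1 \<and> Re z = c"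
proof -
  have pow: "cis (pi * real k / 6) ^ 12 = 1" for k
  proof -
    have "cis (pi * real k / 6) ^ 12 = cis (2 * pi) ^ k"
      unfolding DeMoivre by (simp add: mult_ac)
    then show ?thesis
      by simp
  qed
  have "\<exists>k. cos (pi * real k / 6) = \<bar>c\<bar>"
  proof -
    have "cos (pi * real 0 / 6) = 1" "cos (pi * real 1 / 6) = sqrt 3 / 2"
      "cos (pi * real 2 / 6) = 1 / 2" "cos (pi * real 3 / 6) = 0"
      using cos_30 cos_60 by simp_all
    moreover have "\<bar>c\<bar> \<in> {1, sqrt 3 / 2, 1 / 2, 0}"
    proof -
      have "\<exists>t\<in>{1, sqrt 3 / 2, 1 / 2, 0}. c = t \<or> c = - t"
        using assms by (simp only: insert_iff empty_iff bex_simps) blast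
      moreover have "\<forall>t\<in>{1, sqrt 3 / 2, 1 / 2, 0 :: real}. \<bar>t\<bar> = t"
        by simp
      ultimately show ?thesis
        by (metis abs_minus_cancel)
    qed
    ultimately show ?thesis
      by (metis insert_iff empty_iff)
  qed
  then obtain k where k: "cos (pi * real k / 6) = \<bar>c\<bar>" ..
  define z where "z = (if c \<ge> 0 then cis (pi * real k / 6) else - cis (pi * real k / 6))"
  have "z ^ 12 = 1" "Re z = c"
    using pow[of k] k by (auto simp: z_def)
  then show ?thesis
    by blast
qed

lemma ratio_traces_realized:
  assumes "s \<in> ratio_traces"
  shows "\<exists>N z w. N \<ge> 3 \<and> z ^ N = 1 \<and> w ^ N = 1 \<and> rel s (chord2 1 z) (chord2 1 w)"
proof -
  \<comment> \<open>The 12-gon serves every value except 3, 6 and 7, which are taken from the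
    pentagon, the octagon and the decagon.\<close>
  have twelve: ?thesis if cd: "c \<in> {1, 1 / 2, 0, sqrt 3 / 2, - 1, - (1 / 2), - (sqrt 3 / 2)}"
    "d \<in> {1, 1 / 2, 0, sqrt 3 / 2, - 1, - (1 / 2), - (sqrt 3 / 2)}"
    and "rel s (2 - 2 * c) (2 - 2 * d)" for c d
  proof -
    obtain z w where "z ^ 12 = 1" "Re z = c" "w ^ 12 = 1" "Re w = d"
      using root_of_unity_12[OF cd(1)] root_of_unity_12[OF cd(2)] by blast
    then show ?thesis
      using that(3) by (intro exI[of _ 12] exI[of _ z] exI[of _ w]) (simp add: chord2_def)
  qed
  have sqrt3: "sqrt 3 < 2"
    by (rule real_less_lsqrt) simp_all
  have five: "\<exists>z. z ^ 5 = 1 \<and> chord2 1 z = 2 - 2 * Re z \<and> chord2 1 (z\<^sup>2) = 3 + 2 * Re z \<and> 4 * (Re z)\<^sup>2 + 2 * Re z = 1 \<and> \<bar>Re z\<bar> < 1"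
  proof -
    define z where "z = cis (2 * pi / 5)"
    have z5: "z ^ 5 = 1"
      by (simp add: z_def DeMoivre)
    have norm: "cmod z = 1"
      by (simp add: z_def)
    have "cos (2 * pi / 5) \<noteq> 1"
    proof
      assume "cos (2 * pi / 5) = 1"
      moreover have "cos (2 * pi / 5) < cos 0"
        by (rule cos_monotone_0_pi) (use pi_gt_zero in auto)
      ultimately show False
        by simp
    qed
    then have "Re z \<noteq> 1"
      by (simp add: z_def)
    then have "z \<noteq> 1"
      by auto
    have "(1 - z) * (1 + z + z\<^sup>2 + z ^ 3 + z ^ 4) = 1 - z ^ 5"
      by algebra
    then have sum: "1 + z + z\<^sup>2 + z ^ 3 + z ^ 4 = 0"
      using z5 \<open>z \<noteq> 1\<close> by simp
    have "(z\<^sup>2) ^ 5 = 1"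
      using z5 by (metis mult.commute power_mult power_one)
    have "z ^ 4 = cnj z"
      using cnj_root_of_unity[OF z5] by simp
    moreover have "z ^ 3 = cnj (z\<^sup>2)"
    proof -
      have "cnj (z\<^sup>2) = z ^ 8"
        using cnj_root_of_unity[OF \<open>(z\<^sup>2) ^ 5 = 1\<close>] by (simp add: power_mult[symmetric])
      also have "\<dots> = z ^ 5 * z ^ 3"
        by (simp add: power_add[symmetric])
      finally show ?thesis
        using z5 by simp
    qed
    ultimately have "Re (1 + z + z\<^sup>2 + cnj (z\<^sup>2) + cnj z) = 0"
      using sum by simp
    then have re: "1 + 2 * Re z + 2 * Re (z\<^sup>2) = 0"
      by (simp only: plus_complex.sel cnj.simps one_complex.sel)
    have "(Im z)\<^sup>2 = 1 - (Re z)\<^sup>2"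
      using norm by (metis cmod_power2 one_power2 add_diff_cancel_left')
    then have "Re (z\<^sup>2) = 2 * (Re z)\<^sup>2 - 1"
      by (simp add: Re_power2)
    with re have quad: "4 * (Re z)\<^sup>2 + 2 * Re z = 1"
      by simp
    have "\<bar>Re z\<bar> \<le> 1"
      using abs_Re_le_cmod[of z] norm by simp
    moreover have "Re z \<noteq> - 1"
      using quad by auto
    ultimately have "\<bar>Re z\<bar> < 1"
      using \<open>Re z \<noteq> 1\<close> by linarith
    moreover have "chord2 1 (z\<^sup>2) = 3 + 2 * Re z"
      using re by (simp add: chord2_def)
    ultimately show ?thesis
      using z5 quad by (intro exI[of _ z]) (simp add: chord2_def)
  qed
  from assms consider "s = 2" | "s = 3" | "s = 17/4" | "s = 6" | "s = 4" | "s = 7" | "s = 14"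
    | "s = 5/2" | "s = 13/6" | "s = 10/3" | "s = 25/12"
    unfolding ratio_traces_def by blast
  then show ?thesis
  proof cases
    assume "s = 2"
    then show ?thesis
      by (intro twelve[of "- 1" "- 1"]) (auto simp: rel_def)
  next
    assume "s = 17/4"
    then show ?thesis
      by (intro twelve[of "- 1" "1/2"]) (auto simp: rel_def)
  next
    assume "s = 4"
    then show ?thesis
      by (intro twelve[of "- (sqrt 3 / 2)" "1/2"]) (auto simp: rel_def power2_eq_square algebra_simps intro: add_pos_pos)
  next
    assume "s = 14"
    then show ?thesis
      using sqrt3 by (intro twelve[of "- (sqrt 3 / 2)" "sqrt 3 / 2"]) (auto simp: rel_def power2_eq_square algebra_simps intro: add_pos_pos)
  next
    assume "s = 5/2"
    then show ?thesis
      by (intro twelve[of "- 1" 0]) (auto simp: rel_def)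
  next
    assume "s = 13/6"
    then show ?thesis
      by (intro twelve[of "- (1/2)" 0]) (auto simp: rel_def)
  next
    assume "s = 10/3"
    then show ?thesis
      by (intro twelve[of "- (1/2)" "1/2"]) (auto simp: rel_def)
  next
    assume "s = 25/12"
    then show ?thesis
      by (intro twelve[of "- 1" "- (1/2)"]) (auto simp: rel_def)
  next
    assume s: "s = 6"
    define z where "z = cis (pi / 4)"
    have "z ^ 8 = 1"
      by (simp add: z_def DeMoivre)
    moreover have "rel s (chord2 1 z) (chord2 1 (- z))"
      using sqrt2_less_2 by (auto simp: s z_def chord2_def cos_45 rel_def power2_eq_square algebra_simps intro: add_pos_pos)
    ultimately show ?thesis
      by (intro exI[of _ 8] exI[of _ z] exI[of _ "- z"]) simp
  next
    assume s: "s = 3"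
    obtain z where z: "z ^ 5 = 1" "chord2 1 z = 2 - 2 * Re z" "chord2 1 (z\<^sup>2) = 3 + 2 * Re z"
      "4 * (Re z)\<^sup>2 + 2 * Re z = 1" "\<bar>Re z\<bar> < 1"
      using five by blast
    have "(z\<^sup>2) ^ 5 = 1"
      using z(1) by (metis mult.commute power_mult power_one)
    moreover have "rel s (chord2 1 z) (chord2 1 (z\<^sup>2))"
      unfolding z(2,3) rel_def s using z(4,5) by (auto simp: power2_eq_square algebra_simps)
    ultimately show ?thesis
      using z(1) by (intro exI[of _ 5] exI[of _ z] exI[of _ "z\<^sup>2"]) simp
  next
    assume s: "s = 7"
    obtain z where z: "z ^ 5 = 1" "chord2 1 z = 2 - 2 * Re z" "chord2 1 (z\<^sup>2) = 3 + 2 * Re z"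
      "4 * (Re z)\<^sup>2 + 2 * Re z = 1" "\<bar>Re z\<bar> < 1"
      using five by blast
    have "z ^ 10 = 1" "(z\<^sup>2) ^ 10 = 1"
      using z(1) power_mult[of z 5 2] power_mult[of z 5 4] by (simp_all add: power_mult[symmetric])
    moreover have "rel s (chord2 1 (- z)) (chord2 1 (- (z\<^sup>2)))"
    proof -
      \<comment> \<open>These are \<open>g^2\<close> and \<open>g^(-2)\<close> in some order, for
        the golden ratio \<open>g\<close>, so that the sum of their squares is 7.\<close>
      define a b where "a = 2 + 2 * Re z" and "b = 1 - 2 * Re z"
      have ab: "a * b = 1" "a\<^sup>2 + b\<^sup>2 = 7"
        using z(4) by (simp_all add: a_def b_def power2_eq_square algebra_simps)
      have "a > 0"
        using z(5) by (simp add: a_def)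
      moreover have "b = 1 / a"
        using ab(1) \<open>a > 0\<close> by (simp add: field_simps)
      ultimately have "rel s a b"
        using ab by (simp add: rel_def s mult.assoc)
      moreover have "chord2 1 (- z) = a" "chord2 1 (- (z\<^sup>2)) = b"
        unfolding chord2_uminus_right z(2,3) by (simp_all add: a_def b_def)
      ultimately show ?thesis
        by simp
    qed
    ultimately show ?thesis
      by (intro exI[of _ 10] exI[of _ "- z"] exI[of _ "- (z\<^sup>2)"]) simp
  qed
qed

text \<open>The pair \<open>p^2\<close>, 1 satisfies the same relation, so \<open>rel_cases\<close>
  compares the two ratios. The inverse ratio is harmless, as the two diagonals may be
  exchanged.\<close>

lemma rel_imp_power2_cases:
  assumes "rel s a b" "p\<^sup>2 + 1 / p\<^sup>2 = s" "p > 0"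
  shows "p\<^sup>2 = a / b \<or> p\<^sup>2 = b / a"
proof -
  have "s * p\<^sup>2 = (p\<^sup>2)\<^sup>2 + 1"
    using assms(3) unfolding assms(2)[symmetric] by (simp add: distrib_right power2_eq_square[of "p\<^sup>2"])
  then have "rel s (p\<^sup>2) 1"
    using assms(3) by (simp add: rel_def)
  from assms(1) this show ?thesis
    using assms(1) by (cases rule: rel_cases) (auto simp: rel_def field_simps)
qed

theorem theorem1p1:
  fixes y0 :: complex
  assumes "algebraic y0" and "y0\<^sup>2 \<in> \<rat>"
  shows "ratio_of_polygon_diagonals (phi y0) \<longleftrightarrow>
    y0 \<in> complex_of_real `
      {0, 1, -1, 3/2, -(3/2), 2, -2,
       sqrt 2, -sqrt 2, sqrt 5, -sqrt 5, sqrt 12, -sqrt 12,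
       sqrt 2 / 2, -(sqrt 2 / 2), sqrt 6 / 6, -(sqrt 6 / 6),
       2 * sqrt 3 / 3, -(2 * sqrt 3 / 3), sqrt 12 / 12, -(sqrt 12 / 12)}"
    (is "_ \<longleftrightarrow> y0 \<in> complex_of_real ` ?S")
proof
  assume "ratio_of_polygon_diagonals (phi y0)"
  then obtain N z w where N: "N \<ge> 3" and z: "z ^ N = 1" "z \<noteq> 1" and w: "w ^ N = 1" "w \<noteq> 1"
    and phi: "phi y0 = complex_of_real (cmod (1 - z) / cmod (1 - w))"
    unfolding ratio_of_polygon_diagonals_iff by blast
  have "N > 0"
    using N by simp
  define x where "x = cmod (1 - z) / cmod (1 - w)"
  have "x > 0"
    using z(2) w(2) by (simp add: x_def)
  \<comment> \<open>The quadratic equation determines its coefficient from a nonzero root: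
    \<open>y0 = x - 1 / x\<close>. In particular \<open>y0\<close> is real.\<close>
  define y where "y = x - 1 / x"
  have "(complex_of_real x)\<^sup>2 - y0 * complex_of_real x - 1 = 0"
    using phi_root[of y0] unfolding phi x_def .
  then have y0: "y0 = complex_of_real y"
    using \<open>x > 0\<close> by (simp add: y_def field_simps power2_eq_square)
  have "complex_of_real (y\<^sup>2) \<in> \<rat>"
    using assms(2) by (simp add: y0)
  then have "y\<^sup>2 + 2 \<in> \<rat>"
    unfolding of_real_Rats_complex_iff by simp
  moreover have "rel (y\<^sup>2 + 2) (chord2 1 z) (chord2 1 w)"
  proof -
    have cz: "chord2 1 z = (cmod (1 - z))\<^sup>2" and cw: "chord2 1 w = (cmod (1 - w))\<^sup>2"
      using norm_one_minus_power2 norm_root_of_unity[OF _ \<open>N > 0\<close>] z w by metis+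
    have pos: "chord2 1 z > 0" "chord2 1 w > 0"
      using z(2) w(2) by (simp_all add: cz cw)
    have x2: "chord2 1 z = x\<^sup>2 * chord2 1 w"
      using w(2) by (simp add: cz cw x_def power_divide)
    have "(y\<^sup>2 + 2) * x\<^sup>2 = (x\<^sup>2)\<^sup>2 + 1"
      using \<open>x > 0\<close> by (simp add: y_def field_simps power2_eq_square)
    then have "(y\<^sup>2 + 2) * x\<^sup>2 * (chord2 1 w)\<^sup>2 = ((x\<^sup>2)\<^sup>2 + 1) * (chord2 1 w)\<^sup>2"
      by simp
    then show ?thesis
      using pos unfolding rel_def x2 by (simp add: power2_eq_square algebra_simps)
  qed
  ultimately have "y\<^sup>2 + 2 \<in> ratio_traces"
    using rel_chord2_ratio_traces[OF z(1) w(1) \<open>N > 0\<close>] by blast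
  then show "y0 \<in> complex_of_real ` ?S"
    unfolding square_plus_2_mem_ratio_traces_iff y0 by (rule imageI)
next
  assume "y0 \<in> complex_of_real ` ?S"
  then obtain y where y0: "y0 = complex_of_real y" and "y \<in> ?S"
    by blast
  then have "y\<^sup>2 + 2 \<in> ratio_traces"
    unfolding square_plus_2_mem_ratio_traces_iff by blast
  then obtain N z w where N: "N \<ge> 3" and z: "z ^ N = 1" and w: "w ^ N = 1"
    and rel: "rel (y\<^sup>2 + 2) (chord2 1 z) (chord2 1 w)"
    using ratio_traces_realized by blast
  define p where "p = (y + sqrt (y\<^sup>2 + 4)) / 2"
  have "\<bar>y\<bar> < sqrt (y\<^sup>2 + 4)"
    by (rule real_less_rsqrt) simp
  then have "p > 0"
    by (simp add: p_def)
  have phi: "phi y0 = complex_of_real p"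
    by (simp only: y0 phi_of_real p_def)
  have "2 * p = y + sqrt (y\<^sup>2 + 4)"
    by (simp add: p_def)
  then have "2 * p - y = sqrt (y\<^sup>2 + 4)"
    by simp
  then have "(2 * p - y)\<^sup>2 = y\<^sup>2 + 4"
    by simp
  then have "p\<^sup>2 = y * p + 1"
    by (simp add: power2_eq_square algebra_simps)
  then have "y = p - 1 / p"
    using \<open>p > 0\<close> by (simp add: field_simps power2_eq_square)
  then have "p\<^sup>2 + 1 / p\<^sup>2 = y\<^sup>2 + 2"
    using \<open>p > 0\<close> by (simp add: power2_diff power_divide)
  then have p2: "p\<^sup>2 = chord2 1 z / chord2 1 w \<or> p\<^sup>2 = chord2 1 w / chord2 1 z"
    using rel_imp_power2_cases[OF rel] \<open>p > 0\<close> by blast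
  have "N > 0"
    using N by simp
  then have cz: "chord2 1 z = (cmod (1 - z))\<^sup>2" and cw: "chord2 1 w = (cmod (1 - w))\<^sup>2"
    using norm_one_minus_power2 norm_root_of_unity z w by metis+
  have "z \<noteq> 1" "w \<noteq> 1"
    using rel by (auto simp: rel_def chord2_def)
  have "p = cmod (1 - z) / cmod (1 - w) \<or> p = cmod (1 - w) / cmod (1 - z)"
    using p2 \<open>p > 0\<close> unfolding cz cw power_divide[symmetric] by (auto dest: power2_eq_imp_eq)
  then show "ratio_of_polygon_diagonals (phi y0)"
    unfolding ratio_of_polygon_diagonals_iff phi using N z w \<open>z \<noteq> 1\<close> \<open>w \<noteq> 1\<close> by blast
qed

end
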